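(* Let $\mathcal{D}=\{X\in\mathbb{R}^{n\times p}:\ \operatorname{rank}(X)\le k,\ f(\lambda(X))\le 0\}$, where $\lambda(X)$ is the vector of singular values of $X$, and let $\tilde k\le k$ be its strengthened rank. Consider $$V_{\rm opt}:=\min_{X\in\mathcal{D}}\{\langle A_0,X\rangle:\ b_i^l\le\langle A_i,X\rangle\le b_i^u,\ \forall i\in[m]\}\quad\text{(LSOP)},$$ $$V_{\rm rel}:=\min_{X\in\operatorname{conv}(\mathcal{D})}\{\langle A_0,X\rangle:\ b_i^l\le\langle A_i,X\rangle\le b_i^u,\ \forall i\in[m]\}\quad\text{(LSOP-R)},$$ and let $\tilde m$ be the number of linearly independent matrices among $A_1,\dots,A_m$. If $\tilde m\le (k-\tilde k+2)(k-\tilde k+3)/2-2$, then: (i) every extreme point of the feasible set of LSOP-R has rank at most $k$; and (ii) LSOP-R achieves the same optimal value as LSOP, i.e., $V_{\rm opt}=V_{\rm rel}$, if LSOP-R yields a finite optimal value, i.e., $V_{\rm rel}>-\infty$, and its feasible set contains no line.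
   Context: $k\le n\le p$ are positive integers; $[m]=\{1,\dots,m\}$; $\langle\cdot,\cdot\rangle$ is the Frobenius inner product; $\operatorname{conv}$ denotes convex hull. For $X\in\mathbb{R}^{n\times p}$, $\lambda(X)\in\mathbb{R}_+^n$ is the vector of its $n$ singular values. The function $f:\mathbb{R}^n\to\mathbb{R}$ is continuous, convex, symmetric (invariant under permutations of its arguments) and, since singular values are nonnegative, is taken to be sign-invariant ($f(\lambda)=f(|\lambda|)$ with $|\cdot|$ entrywise); thus $X\mapsto f(\lambda(X))$ is a continuous convex function on $\mathbb{R}^{n\times p}$. $A_0,A_1,\dots,A_m\in\mathbb{R}^{n\times p}$ and $-\infty\le b_i^l\le b_i^u\le+\infty$. The number $\tilde m$ is the dimension of the linear span of $\{A_i\}_{i\in[m]}$. Strengthened rank: $\tilde k$ with $1\le\tilde k\le k$ is the smallest integer such that $\operatorname{conv}(\mathcal{D})=\operatorname{conv}(\{X\in\mathbb{R}^{n\times p}:\ \operatorname{rank}(X)\le\tilde k,\ f(\lambda(X))\le0\})$. *)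

theory Defs
  imports "HOL-Analysis.Analysis"
begin

text \<open>
  An \<open>n\<close> by \<open>p\<close> matrix is an element of \<^typ>\<open>real^'p^'n\<close>; the library inner product on this type is the
  Frobenius inner product, and \<^const>\<open>rank\<close> is the usual matrix rank.
\<close>

definition diag_matrix :: "real^'n \<Rightarrow> real^'n^'n" where
  "diag_matrix s = (\<chi> i j. if i = j then s $ i else 0)"

text \<open>
  Reduced singular value decomposition \<open>X = U diag(s) V\<^sup>T\<close> with \<open>U\<close> square orthogonal and \<open>V\<close> having
  orthonormal columns, for matrices with at most as many rows as columns.
\<close>

definition is_singular_values :: "real^'p^'n \<Rightarrow> real^'n \<Rightarrow> bool" where
  "is_singular_values X s \<longleftrightarrow>
     (\<forall>i. 0 \<le> s $ i) \<and>
     (\<exists>(U :: real^'n^'n) (V :: real^'n^'p).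
        orthogonal_matrix U \<and> transpose V ** V = mat 1 \<and>
        X = U ** diag_matrix s ** transpose V)"

text \<open>
  The index type carries no order, so the entries come in an unspecified order; they are determined
  up to a permutation, and the vector is only ever passed to permutation-invariant functions.
  A vector as required exists by \<open>is_singular_values_singular_values\<close> below.
\<close>

definition singular_values :: "real^'p^'n \<Rightarrow> real^'n" where
  "singular_values X = (SOME s. is_singular_values X s)"

definition permutation_invariant :: "(real^'n \<Rightarrow> real) \<Rightarrow> bool" where
  "permutation_invariant f \<longleftrightarrow> (\<forall>\<pi> x. bij \<pi> \<longrightarrow> f (\<chi> i. x $ \<pi> i) = f x)"

definition sign_invariant :: "(real^'n \<Rightarrow> real) \<Rightarrow> bool" where
  "sign_invariant f \<longleftrightarrow> (\<forall>x. f x = f (\<chi> i. \<bar>x $ i\<bar>))"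

definition spectral_domain :: "nat \<Rightarrow> (real^'n \<Rightarrow> real) \<Rightarrow> (real^'p^'n) set" where
  "spectral_domain k f = {X. rank X \<le> k \<and> f (singular_values X) \<le> 0}"

text \<open>
  The type argument fixes the number of columns \<open>p\<close>, which does not occur in the type of \<open>f\<close>.
\<close>

definition strengthened_rank :: "'p::finite itself \<Rightarrow> nat \<Rightarrow> (real^'n \<Rightarrow> real) \<Rightarrow> nat" where
  "strengthened_rank _ k f =
     (LEAST r. 1 \<le> r \<and> r \<le> k \<and>
        convex hull (spectral_domain k f :: (real^'p^'n) set) = convex hull (spectral_domain r f))"

definition feasible_set ::
  "'a::real_inner set \<Rightarrow> nat \<Rightarrow> (nat \<Rightarrow> 'a) \<Rightarrow> (nat \<Rightarrow> ereal) \<Rightarrow> (nat \<Rightarrow> ereal) \<Rightarrow> 'a set" where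
  "feasible_set S m A bl bu =
     {X \<in> S. \<forall>i\<in>{1..m}. bl i \<le> ereal (A i \<bullet> X) \<and> ereal (A i \<bullet> X) \<le> bu i}"

text \<open>
  The optimal value is the infimum: \<open>\<infinity>\<close> for an infeasible problem and \<open>-\<infinity>\<close> for an unbounded one.
\<close>

definition optimal_value ::
  "'a::real_inner set \<Rightarrow> nat \<Rightarrow> (nat \<Rightarrow> 'a) \<Rightarrow> (nat \<Rightarrow> ereal) \<Rightarrow> (nat \<Rightarrow> ereal) \<Rightarrow> ereal" where
  "optimal_value S m A bl bu = (INF X\<in>feasible_set S m A bl bu. ereal (A 0 \<bullet> X))"

definition contains_line :: "'a::real_vector set \<Rightarrow> bool" where
  "contains_line S \<longleftrightarrow> (\<exists>x d. d \<noteq> 0 \<and> (\<forall>t::real. x + t *\<^sub>R d \<in> S))"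

lemma exists_orthogonal_unit:
  fixes f :: "'i \<Rightarrow> 'a::euclidean_space"
  assumes "finite S" "card S < DIM('a)"
  shows "\<exists>x. norm x = 1 \<and> (\<forall>i\<in>S. f i \<bullet> x = 0)"
proof -
  have "dim (f ` S) \<le> card (f ` S)"
    using assms(1) by (intro dim_le_card') auto
  also have "\<dots> \<le> card S"
    using assms(1) by (rule card_image_le)
  finally have "dim (f ` S) < DIM('a)"
    using assms(2) by linarith
  then obtain x where x: "x \<noteq> 0" "\<And>y. y \<in> span (f ` S) \<Longrightarrow> orthogonal x y"
    using orthogonal_to_subspace_exists[of "f ` S"] by blast
  have "f i \<bullet> x = 0" if "i \<in> S" for i
    using x(2)[of "f i"] that by (simp add: span_base orthogonal_def inner_commute)
  then have "norm (x /\<^sub>R norm x) = 1 \<and> (\<forall>i\<in>S. f i \<bullet> (x /\<^sub>R norm x) = 0)"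
    using x(1) by simp
  then show ?thesis by blast
qed

lemma inner_le_imp_eq_scaleR:
  fixes u w :: "'a::real_inner"
  assumes "norm u = 1" "u \<bullet> w = s" "0 \<le> s"
    and le: "w \<noteq> 0 \<Longrightarrow> (w /\<^sub>R norm w) \<bullet> w \<le> s"
  shows "w = s *\<^sub>R u"
proof -
  have n: "norm w \<le> s"
  proof (cases "w = 0")
    case False
    have "(w /\<^sub>R norm w) \<bullet> w = norm w"
      using False by (simp add: dot_square_norm power2_eq_square)
    with le[OF False] show ?thesis by simp
  qed (use assms in simp)
  have "(norm (w - s *\<^sub>R u))\<^sup>2 = (norm w)\<^sup>2 - 2 * s * (u \<bullet> w) + s\<^sup>2 * (norm u)\<^sup>2"
    unfolding power2_norm_eq_inner by (simp add: inner_diff inner_commute algebra_simps power2_eq_square)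
  also have "\<dots> = (norm w)\<^sup>2 - s\<^sup>2"
    using assms by (simp add: power2_eq_square)
  also have "\<dots> \<le> 0"
    using n by (simp add: power_mono)
  finally show ?thesis by simp
qed

lemma exists_singular_system:
  fixes X :: "real^'p^'n"
  assumes "finite S" "CARD('n) \<le> CARD('p)"
  shows "\<exists>(u :: 'n \<Rightarrow> real^'n) (v :: 'n \<Rightarrow> real^'p) s.
      (\<forall>i\<in>S. 0 \<le> s i \<and> X *v v i = s i *\<^sub>R u i \<and> u i v* X = s i *\<^sub>R v i) \<and>
      (\<forall>i\<in>S. \<forall>j\<in>S. u i \<bullet> u j = (if i = j then 1 else 0) \<and> v i \<bullet> v j = (if i = j then 1 else 0))"
  using assms(1)
proof (induction S rule: finite_induct)
  case empty
  show ?case by simp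
next
  case (insert a S)
  then obtain u :: "'n \<Rightarrow> real^'n" and v :: "'n \<Rightarrow> real^'p" and s where
    sv: "\<And>i. i \<in> S \<Longrightarrow> 0 \<le> s i" "\<And>i. i \<in> S \<Longrightarrow> X *v v i = s i *\<^sub>R u i"
        "\<And>i. i \<in> S \<Longrightarrow> u i v* X = s i *\<^sub>R v i"
    and on: "\<And>i j. i \<in> S \<Longrightarrow> j \<in> S \<Longrightarrow> u i \<bullet> u j = (if i = j then 1 else 0)"
        "\<And>i j. i \<in> S \<Longrightarrow> j \<in> S \<Longrightarrow> v i \<bullet> v j = (if i = j then 1 else 0)"
    by blast
  have adj: "y \<bullet> (X *v x) = (y v* X) \<bullet> x" for x y
    by (simp add: dot_lmul_matrix)
  have "card S < CARD('n)"
    using insert.hyps by (metis UNIV_I finite_UNIV psubset_card_mono psubsetI subset_UNIV finite)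
  define KU where "KU = {x. norm x = 1 \<and> (\<forall>i\<in>S. u i \<bullet> x = 0)}"
  define KV where "KV = {x. norm x = 1 \<and> (\<forall>i\<in>S. v i \<bullet> x = 0)}"
  have ne: "KU \<noteq> {}" "KV \<noteq> {}"
    using exists_orthogonal_unit[OF insert.hyps(1), of u] exists_orthogonal_unit[OF insert.hyps(1), of v]
      \<open>card S < CARD('n)\<close> assms(2) by (auto simp: KU_def KV_def)
  have KU_eq: "KU = sphere 0 1 \<inter> (\<Inter>i\<in>S. {x. u i \<bullet> x = 0})"
    by (auto simp: KU_def)
  have KV_eq: "KV = sphere 0 1 \<inter> (\<Inter>i\<in>S. {x. v i \<bullet> x = 0})"
    by (auto simp: KV_def)
  have "compact KU" "compact KV"
    unfolding KU_eq KV_eq by (intro compact_Int_closed closed_INT ballI closed_hyperplane compact_sphere)+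
  then have cK: "compact (KU \<times> KV)" by (rule compact_Times)
  have cont: "continuous_on (KU \<times> KV) (\<lambda>z. fst z \<bullet> (X *v snd z))"
    by (intro continuous_intros continuous_on_compose2[OF matrix_vector_mult_linear_continuous_on, of _ snd]) auto
  have "KU \<times> KV \<noteq> {}"
    using ne by simp
  from continuous_attains_sup[OF cK this cont] obtain z
    where z: "z \<in> KU \<times> KV" "\<forall>y\<in>KU \<times> KV. fst y \<bullet> (X *v snd y) \<le> fst z \<bullet> (X *v snd z)"
    by blast
  obtain a1 b1 where [simp]: "z = (a1, b1)" by force
  define t where "t = a1 \<bullet> (X *v b1)"
  have ab: "a1 \<in> KU" "b1 \<in> KV" and mx: "\<And>x y. x \<in> KU \<Longrightarrow> y \<in> KV \<Longrightarrow> x \<bullet> (X *v y) \<le> t"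
    using z by (auto simp: t_def)
  have "- a1 \<in> KU" using ab by (simp add: KU_def)
  from mx[OF this ab(2)] have t0: "0 \<le> t" by (simp add: t_def)
  have e1: "X *v b1 = t *\<^sub>R a1"
  proof (rule inner_le_imp_eq_scaleR)
    show "norm a1 = 1" "a1 \<bullet> (X *v b1) = t" "0 \<le> t"
      using ab t0 by (auto simp: KU_def t_def)
    assume nz: "X *v b1 \<noteq> 0"
    have "u i \<bullet> (X *v b1) = 0" if "i \<in> S" for i
      using ab(2) that sv(3)[OF that] by (simp add: adj KV_def)
    then have "(X *v b1) /\<^sub>R norm (X *v b1) \<in> KU"
      using nz by (simp add: KU_def)
    from mx[OF this ab(2)] show "((X *v b1) /\<^sub>R norm (X *v b1)) \<bullet> (X *v b1) \<le> t" .
  qed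
  have e2: "a1 v* X = t *\<^sub>R b1"
  proof (rule inner_le_imp_eq_scaleR)
    show "norm b1 = 1" "b1 \<bullet> (a1 v* X) = t" "0 \<le> t"
      using ab t0 by (auto simp: KV_def t_def adj inner_commute)
    assume nz: "a1 v* X \<noteq> 0"
    have "v i \<bullet> (a1 v* X) = 0" if "i \<in> S" for i
    proof -
      have "v i \<bullet> (a1 v* X) = a1 \<bullet> (X *v v i)"
        by (simp add: adj inner_commute)
      also have "\<dots> = 0"
        using ab(1) that sv(2)[OF that] by (simp add: KU_def inner_commute)
      finally show ?thesis .
    qed
    then have "(a1 v* X) /\<^sub>R norm (a1 v* X) \<in> KV"
      using nz by (simp add: KV_def)
    from mx[OF ab(1) this]
    show "((a1 v* X) /\<^sub>R norm (a1 v* X)) \<bullet> (a1 v* X) \<le> t"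
      by (simp add: adj inner_commute)
  qed
  have o: "a1 \<bullet> a1 = 1" "b1 \<bullet> b1 = 1"
      "\<And>i. i \<in> S \<Longrightarrow> u i \<bullet> a1 = 0" "\<And>i. i \<in> S \<Longrightarrow> a1 \<bullet> u i = 0"
      "\<And>i. i \<in> S \<Longrightarrow> v i \<bullet> b1 = 0" "\<And>i. i \<in> S \<Longrightarrow> b1 \<bullet> v i = 0"
    using ab by (auto simp: KU_def KV_def norm_eq_1 inner_commute)
  show ?case
    using insert.hyps(2) sv on o e1 e2 t0
    by (intro exI[of _ "u(a := a1)"] exI[of _ "v(a := b1)"] exI[of _ "s(a := t)"]) auto
qed

lemma is_singular_values_singular_values:
  fixes X :: "real^'p^'n"
  assumes "CARD('n) \<le> CARD('p)"
  shows "is_singular_values X (singular_values X)"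
proof -
  obtain u :: "'n \<Rightarrow> real^'n" and v :: "'n \<Rightarrow> real^'p" and s where
    sv: "\<And>i. 0 \<le> s i" "\<And>i. u i v* X = s i *\<^sub>R v i"
    and on: "\<And>i j. u i \<bullet> u j = (if i = j then 1 else 0)"
            "\<And>i j. v i \<bullet> v j = (if i = j then 1 else 0)"
    using exists_singular_system[OF finite assms, of UNIV X] by auto blast
  define U :: "real^'n^'n" where "U = (\<chi> i j. u j $ i)"
  define V :: "real^'n^'p" where "V = (\<chi> i j. v j $ i)"
  have U: "orthogonal_matrix U"
    using on(1) by (simp add: orthogonal_matrix U_def transpose_def matrix_matrix_mult_def
        mat_def vec_eq_iff inner_vec_def)
  have V: "transpose V ** V = mat 1"
    using on(2) by (simp add: V_def transpose_def matrix_matrix_mult_def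
        mat_def vec_eq_iff inner_vec_def)
  have "transpose U ** X = diag_matrix (\<chi> i. s i) ** transpose V"
  proof -
    have "(transpose U ** X) $ i $ j = (u i v* X) $ j" for i j
      by (simp add: U_def transpose_def matrix_matrix_mult_def vector_matrix_mult_def mult.commute)
    moreover have "(diag_matrix (\<chi> i. s i) ** transpose V) $ i $ j = s i * v i $ j" for i j
      by (simp add: diag_matrix_def V_def transpose_def matrix_matrix_mult_def if_distrib[of "\<lambda>x. x * _"]
          cong: if_cong)
    ultimately show ?thesis
      by (simp add: vec_eq_iff sv(2))
  qed
  then have "X = U ** (diag_matrix (\<chi> i. s i) ** transpose V)"
    using U by (metis matrix_mul_assoc matrix_mul_lid orthogonal_matrix_def)
  then have "is_singular_values X (\<chi> i. s i)"
    using U V sv(1) unfolding is_singular_values_def by (auto simp: matrix_mul_assoc)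
  then show ?thesis
    unfolding singular_values_def by (rule someI)
qed

end

theory Submission
  imports Defs
begin

text \<open>
  Write \<open>r\<close> for the strengthened rank, so that the hull of \<open>D\<close> is also the hull of the spectral domain of
  rank \<open>r\<close>. The heart of the matter is that a point \<open>X = U diag(s) V\<^sup>T\<close> of this hull with rank above \<open>k\<close>
  lies in the relative interior of a face of dimension at least \<open>(k - r + 2)(k - r + 3)/2 - 1\<close>. This exceeds the
  dimension of the span of the constraint matrices, so a nonzero direction \<open>\<Delta>\<close> along the face is
  orthogonal to all of them and \<open>X \<plusminus> \<Delta>\<close>, after scaling, is feasible. Hence \<open>X\<close> is not an extreme point.

  To bound the face from below, matrices are first reduced to vectors: the matrix \<open>X\<close> is in the hull exactly
  if \<open>s\<close> is in the hull of the vectors \<open>x\<close> with \<open>f x \<le> 0\<close> and at most \<open>r\<close> nonzero entries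
  (\<open>svd_in_hull_spectral_domain_iff\<close>). This rests on the fact that the diagonal of \<open>U\<^sup>T Y V\<close> is in the hull
  of the signed permutations of the singular values of \<open>Y\<close> (\<open>diagonal_in_hull_signed_permutations\<close>).
  Now \<open>s\<close> has more than \<open>k\<close> nonzero entries but is an average of vectors with at most \<open>r\<close>. Swapping entries
  in single terms of that average shows that mass can be moved in both directions between any two of some
  \<open>k - r + 2\<close> coordinates (\<open>exchangeable_coordinates\<close>). Rotations in coordinate planes turn such
  transfers into all symmetric perturbations of trace zero on the corresponding block of \<open>diag(s)\<close>
  (\<open>traceless_block_direction\<close>).

  For the optimal values there are two cases. If \<open>f\<close> is positive somewhere, its sublevel set is bounded,
  the relaxed feasible set is compact, and a minimum is attained at an extreme point; this has rank at most
  \<open>k\<close> and, as \<open>f \<circ> \<lambda> \<le> 0\<close> is preserved by convex combinations, belongs to \<open>D\<close>. If \<open>f\<close> is nowhere positive, the hull is the whole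
  space, and a feasible point of rank above \<open>k\<close> would yield a feasible line in the direction \<open>\<Delta>\<close>. So all
  feasible points have rank at most \<open>k\<close> and the two feasible sets agree.
\<close>

section \<open>Doubly substochastic weights and signed permutations\<close>

text \<open>
  The rearrangement inequality for doubly substochastic weights, which is what is needed here of the
  Birkhoff--von Neumann theorem. Induction on the number of rows: the row \<open>i0\<close> with the largest \<open>y\<close>
  and the column \<open>j0\<close> with the largest \<open>s\<close> can be matched to each other completely. The mass that
  they exchange with the other columns and rows is rerouted as a rank-one term between those rows and
  columns, which keeps the weights substochastic and cannot lower the objective.
\<close>

lemma substochastic_bilinear_le_assignment:
  fixes M :: "'a \<Rightarrow> 'b \<Rightarrow> real" and y :: "'a \<Rightarrow> real" and s :: "'b \<Rightarrow> real"
  assumes "finite I" "finite J" "card I = card J"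
    and "\<And>i j. i \<in> I \<Longrightarrow> j \<in> J \<Longrightarrow> 0 \<le> M i j"
    and "\<And>i. i \<in> I \<Longrightarrow> (\<Sum>j\<in>J. M i j) \<le> 1"
    and "\<And>j. j \<in> J \<Longrightarrow> (\<Sum>i\<in>I. M i j) \<le> 1"
    and "\<And>i. i \<in> I \<Longrightarrow> 0 \<le> y i" "\<And>j. j \<in> J \<Longrightarrow> 0 \<le> s j"
  shows "\<exists>\<pi>. bij_betw \<pi> I J \<and> (\<Sum>i\<in>I. \<Sum>j\<in>J. M i j * y i * s j) \<le> (\<Sum>i\<in>I. y i * s (\<pi> i))"
  using assms
proof (induction I arbitrary: J M rule: finite_ranking_induct[where f = y])
  case empty
  then show ?case by (auto simp: bij_betw_def)
next
  case (insert i0 I)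
  show ?case
  proof (cases "i0 \<in> I")
    case True
    then have "insert i0 I = I" by auto
    with insert.IH[of J M] insert.prems show ?thesis by simp
  next
    case False
    have J: "finite J" "J \<noteq> {}"
      using insert.prems(1,2) insert.hyps(1) False by auto
    have "Max (s ` J) \<in> s ` J"
      using J by (intro Max_in) auto
    then obtain j0 where "j0 \<in> J" and eq: "Max (s ` J) = s j0"
      by (rule imageE)
    moreover have "s j \<le> s j0" if "j \<in> J" for j
      unfolding eq[symmetric] using J(1) that by (intro Max_ge) auto
    ultimately have j0: "j0 \<in> J" "\<And>j. j \<in> J \<Longrightarrow> s j \<le> s j0"
      by auto
    define K where "K = J - {j0}"
    have K: "finite K" "j0 \<notin> K" "J = insert j0 K" "card I = card K"
      using J j0(1) insert.prems(2) insert.hyps(1) False by (auto simp: K_def card_Diff_singleton)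
    define \<alpha> r c where "\<alpha> = M i0 j0" and "r = M i0" and "c = (\<lambda>i. M i j0)"
    \<comment> \<open>Row \<open>i0\<close> and column \<open>j0\<close> are deleted and their mass \<open>r\<close>, \<open>c\<close> is rerouted in proportion; if \<open>\<alpha> = 1\<close>
      then \<open>r\<close> and \<open>c\<close> vanish and the division by zero is harmless.\<close>
    define M' where "M' = (\<lambda>i j. M i j + c i * r j / (1 - \<alpha>))"
    have nn: "\<And>i j. i \<in> I \<Longrightarrow> j \<in> K \<Longrightarrow> 0 \<le> M i j" "\<And>j. j \<in> K \<Longrightarrow> 0 \<le> r j"
      "\<And>i. i \<in> I \<Longrightarrow> 0 \<le> c i" "0 \<le> \<alpha>"
      using insert.prems(3) j0(1) by (auto simp: K_def \<alpha>_def r_def c_def)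
    have rs: "\<alpha> + sum r K \<le> 1"
      using insert.prems(4)[of i0] K by (simp add: \<alpha>_def r_def)
    have cs: "\<alpha> + sum c I \<le> 1"
      using insert.prems(5)[of j0] j0(1) False insert.hyps(1) by (simp add: \<alpha>_def c_def)
    have rsi: "c i + (\<Sum>j\<in>K. M i j) \<le> 1" if "i \<in> I" for i
      using insert.prems(4)[of i] that K by (simp add: c_def)
    have csj: "r j + (\<Sum>i\<in>I. M i j) \<le> 1" if "j \<in> K" for j
      using insert.prems(5)[of j] that K False insert.hyps(1) by (simp add: r_def)
    have a1: "0 \<le> 1 - \<alpha>"
      using rs sum_nonneg[of K r] nn by fastforce
    have y: "0 \<le> y i0" "\<And>i. i \<in> I \<Longrightarrow> 0 \<le> y i" "\<And>i. i \<in> I \<Longrightarrow> y i \<le> y i0"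
      using insert.prems(6) insert.hyps(2) by auto
    have s: "0 \<le> s j0" "\<And>j. j \<in> K \<Longrightarrow> 0 \<le> s j" "\<And>j. j \<in> K \<Longrightarrow> s j \<le> s j0"
      using insert.prems(7) j0 by (auto simp: K_def)
    have share: "sum r K / (1 - \<alpha>) \<le> 1" "sum c I / (1 - \<alpha>) \<le> 1"
      using rs cs a1 by (auto simp: divide_le_eq_1)
    have M'nn: "0 \<le> M' i j" if "i \<in> I" "j \<in> K" for i j
      using nn that a1 by (auto simp: M'_def)
    have M'row: "(\<Sum>j\<in>K. M' i j) \<le> 1" if "i \<in> I" for i
    proof -
      have "(\<Sum>j\<in>K. M' i j) = (\<Sum>j\<in>K. M i j) + c i * (sum r K / (1 - \<alpha>))"
        by (simp add: M'_def sum.distrib sum_distrib_left sum_divide_distrib)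
      also have "\<dots> \<le> (\<Sum>j\<in>K. M i j) + c i * 1"
        using share(1) nn(3)[OF that] by (intro add_left_mono mult_left_mono) auto
      finally show ?thesis using rsi[OF that] by simp
    qed
    have M'col: "(\<Sum>i\<in>I. M' i j) \<le> 1" if "j \<in> K" for j
    proof -
      have "(\<Sum>i\<in>I. M' i j) = (\<Sum>i\<in>I. M i j) + (sum c I / (1 - \<alpha>)) * r j"
        by (simp add: M'_def sum.distrib sum_distrib_right sum_divide_distrib)
      also have "\<dots> \<le> (\<Sum>i\<in>I. M i j) + 1 * r j"
        using share(2) nn(2)[OF that] by (intro add_left_mono mult_right_mono) auto
      finally show ?thesis using csj[OF that] by simp
    qed
    obtain \<pi> where \<pi>: "bij_betw \<pi> I K"
      "(\<Sum>i\<in>I. \<Sum>j\<in>K. M' i j * y i * s j) \<le> (\<Sum>i\<in>I. y i * s (\<pi> i))"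
      using insert.IH[OF K(1) K(4) M'nn M'row M'col] y s by blast
    define R C where "R = (\<Sum>j\<in>K. r j * s j)" and "C = (\<Sum>i\<in>I. c i * y i)"
    have "R \<le> (\<Sum>j\<in>K. r j * s j0)"
      unfolding R_def using nn s by (intro sum_mono mult_left_mono) auto
    then have "R \<le> sum r K * s j0" by (simp add: sum_distrib_right)
    also have "\<dots> \<le> (1 - \<alpha>) * s j0"
      using rs s by (intro mult_right_mono) auto
    finally have R: "R \<le> (1 - \<alpha>) * s j0" .
    have "C \<le> (\<Sum>i\<in>I. c i * y i0)"
      unfolding C_def using nn y by (intro sum_mono mult_left_mono) auto
    then have "C \<le> sum c I * y i0" by (simp add: sum_distrib_right)
    also have "\<dots> \<le> (1 - \<alpha>) * y i0"
      using cs y by (intro mult_right_mono) auto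
    finally have C: "C \<le> (1 - \<alpha>) * y i0" .
    have RC0: "0 \<le> R" "0 \<le> C"
      unfolding R_def C_def using nn y s by (auto intro!: sum_nonneg)
    \<comment> \<open>Both deficits \<open>(1 - \<alpha>) y i0 - C\<close> and \<open>(1 - \<alpha>) s j0 - R\<close> are nonnegative; expand their product.\<close>
    have key: "\<alpha> * y i0 * s j0 + y i0 * R + s j0 * C \<le> y i0 * s j0 + C * R / (1 - \<alpha>)"
    proof (cases "1 - \<alpha> = 0")
      case True
      then show ?thesis using R C RC0 by simp
    next
      case False
      with a1 have p: "1 - \<alpha> > 0" by simp
      have "0 \<le> ((1 - \<alpha>) * y i0 - C) * ((1 - \<alpha>) * s j0 - R) / (1 - \<alpha>)"
        using R C a1 by (intro divide_nonneg_nonneg mult_nonneg_nonneg) auto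
      also have "\<dots> = (1 - \<alpha>) * y i0 * s j0 - y i0 * R - s j0 * C + C * R / (1 - \<alpha>)"
        using p by (simp add: field_simps)
      finally show ?thesis by (simp add: algebra_simps)
    qed
    have M'sum: "(\<Sum>i\<in>I. \<Sum>j\<in>K. M' i j * y i * s j)
        = (\<Sum>i\<in>I. \<Sum>j\<in>K. M i j * y i * s j) + C * R / (1 - \<alpha>)"
      by (simp add: M'_def C_def R_def sum_product sum.distrib sum_divide_distrib algebra_simps
          add_divide_distrib)
    have "(\<Sum>i\<in>insert i0 I. \<Sum>j\<in>J. M i j * y i * s j)
        = \<alpha> * y i0 * s j0 + y i0 * R + s j0 * C + (\<Sum>i\<in>I. \<Sum>j\<in>K. M i j * y i * s j)"
      using K False insert.hyps(1)
      by (simp add: R_def C_def \<alpha>_def r_def c_def sum.distrib sum_distrib_left algebra_simps)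
    also have "\<dots> \<le> y i0 * s j0 + (\<Sum>i\<in>I. \<Sum>j\<in>K. M' i j * y i * s j)"
      using key M'sum by simp
    also have "\<dots> \<le> y i0 * s j0 + (\<Sum>i\<in>I. y i * s (\<pi> i))"
      using \<pi>(2) by simp
    also have "\<dots> = (\<Sum>i\<in>insert i0 I. y i * s ((\<pi>(i0 := j0)) i))"
      using False insert.hyps(1) by (auto intro!: sum.cong)
    finally have le: "(\<Sum>i\<in>insert i0 I. \<Sum>j\<in>J. M i j * y i * s j)
        \<le> (\<Sum>i\<in>insert i0 I. y i * s ((\<pi>(i0 := j0)) i))" .
    have "bij_betw (\<pi>(i0 := j0)) (insert i0 I) J"
      using \<pi>(1) False K(2) unfolding K(3) bij_betw_def by (auto simp: inj_on_def image_def)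
    with le show ?thesis by blast
  qed
qed

definition signed_permutations :: "real^'n \<Rightarrow> (real^'n) set" where
  "signed_permutations x = {(\<chi> i. (if \<epsilon> i then 1 else - 1) * x $ \<pi> i) | \<epsilon> \<pi>. bij \<pi>}"

lemma finite_signed_permutations: "finite (signed_permutations x)"
proof -
  have "signed_permutations x \<subseteq> range (\<lambda>(\<epsilon> :: 'a \<Rightarrow> bool, \<pi>). \<chi> i. (if \<epsilon> i then 1 else - 1) * x $ \<pi> i)"
    by (auto simp: signed_permutations_def image_def)
  then show ?thesis by (rule finite_subset) simp
qed

text \<open>
  The hull is compact, so a point outside it could be strictly separated from all signed permutations
  of \<open>x\<close>; but the assignment bound yields one at which the separating functional is at least as small.
\<close>

lemma substochastic_mult_in_hull:
  fixes M :: "'n \<Rightarrow> 'n::finite \<Rightarrow> real"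
  assumes row: "\<And>i. (\<Sum>j\<in>UNIV. \<bar>M i j\<bar>) \<le> 1" and col: "\<And>j. (\<Sum>i\<in>UNIV. \<bar>M i j\<bar>) \<le> 1"
  shows "(\<chi> i. \<Sum>j\<in>UNIV. M i j * x $ j) \<in> convex hull (signed_permutations x)"
proof (rule ccontr)
  let ?z = "\<chi> i. \<Sum>j\<in>UNIV. M i j * x $ j"
  assume "?z \<notin> convex hull (signed_permutations x)"
  moreover have "closed (convex hull (signed_permutations x))"
    by (intro compact_imp_closed compact_convex_hull finite_imp_compact finite_signed_permutations)
  ultimately obtain a b where ab: "a \<bullet> ?z < b" "\<And>w. w \<in> convex hull (signed_permutations x) \<Longrightarrow> b < a \<bullet> w"
    using separating_hyperplane_closed_point[of "convex hull (signed_permutations x)" ?z] by auto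
  obtain \<pi> where \<pi>: "bij \<pi>"
    "(\<Sum>i\<in>UNIV. \<Sum>j\<in>UNIV. \<bar>M i j\<bar> * \<bar>a $ i\<bar> * \<bar>x $ j\<bar>) \<le> (\<Sum>i\<in>UNIV. \<bar>a $ i\<bar> * \<bar>x $ \<pi> i\<bar>)"
    using substochastic_bilinear_le_assignment[of UNIV UNIV "\<lambda>i j. \<bar>M i j\<bar>" "\<lambda>i. \<bar>a $ i\<bar>" "\<lambda>j. \<bar>x $ j\<bar>"]
      row col by auto
  \<comment> \<open>The signs make every term of \<open>a \<bullet> w\<close> equal to \<open>- \<bar>a $ i\<bar> * \<bar>x $ \<pi> i\<bar>\<close>.\<close>
  define w where "w = (\<chi> i. (if a $ i * x $ \<pi> i \<le> 0 then 1 else - 1) * x $ \<pi> i)"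
  have "w \<in> signed_permutations x"
    unfolding w_def signed_permutations_def using \<pi>(1)
    by (intro CollectI exI[of _ "\<lambda>i. a $ i * x $ \<pi> i \<le> 0"] exI[of _ \<pi>]) simp
  then have "b < a \<bullet> w"
    by (intro ab(2) hull_inc)
  also have "a \<bullet> w = - (\<Sum>i\<in>UNIV. \<bar>a $ i\<bar> * \<bar>x $ \<pi> i\<bar>)"
    unfolding inner_vec_def sum_negf[symmetric] abs_mult[symmetric]
    by (intro sum.cong) (auto simp: w_def)
  also have "\<dots> \<le> - (\<Sum>i\<in>UNIV. \<Sum>j\<in>UNIV. \<bar>M i j\<bar> * \<bar>a $ i\<bar> * \<bar>x $ j\<bar>)"
    using \<pi>(2) by simp
  also have "\<dots> \<le> (\<Sum>i\<in>UNIV. \<Sum>j\<in>UNIV. M i j * a $ i * x $ j)"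
    unfolding sum_negf[symmetric] abs_mult[symmetric] by (intro sum_mono) simp
  also have "\<dots> = a \<bullet> ?z"
    by (simp add: inner_vec_def sum_distrib_left algebra_simps)
  finally show False using ab(1) by simp
qed

section \<open>Diagonals, singular values and spectral functions\<close>

text \<open>
  Column \<open>j\<close> of \<open>transpose A ** B\<close> is the coordinate vector of the orthogonal projection of the unit
  vector \<open>column j B\<close> onto the column space of \<open>A\<close>, so its norm is at most 1.
\<close>

lemma sum_sq_transpose_mult_le:
  fixes A B :: "real^'n^'p"
  assumes A: "transpose A ** A = mat 1" and B: "transpose B ** B = mat 1"
  shows "(\<Sum>i\<in>UNIV. ((transpose A ** B) $ i $ j)\<^sup>2) \<le> 1"
proof -
  define w where "w = column j B"
  define g where "g = w v* A"
  have "w \<bullet> w = (transpose B ** B) $ j $ j"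
    by (simp add: w_def matrix_mult_transpose_dot_column)
  then have w: "norm w = 1"
    by (simp add: B mat_def norm_eq_1)
  have "(A *v g) \<bullet> (A *v g) = g \<bullet> (transpose A *v (A *v g))"
    by (subst inner_commute) (simp add: dot_lmul_matrix)
  also have "\<dots> = g \<bullet> g"
    unfolding matrix_vector_mul_assoc A by simp
  finally have "norm (A *v g) = norm g"
    by (simp add: norm_eq_sqrt_inner)
  moreover have "g \<bullet> g = w \<bullet> (A *v g)"
    by (simp add: g_def dot_lmul_matrix)
  ultimately have "norm g * norm g \<le> norm g"
    using norm_cauchy_schwarz[of w "A *v g"] w by (simp add: dot_square_norm power2_eq_square)
  then have "norm g \<le> 1"
    by (metis mult_le_cancel_left_pos mult.right_neutral norm_ge_zero order_le_less zero_le_one)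
  then have "g \<bullet> g \<le> 1"
    by (simp add: dot_square_norm power_le_one)
  moreover have "g $ i = (transpose A ** B) $ i $ j" for i
    by (simp add: g_def w_def matrix_matrix_mult_def transpose_def vector_matrix_mult_def column_def
        mult.commute)
  ultimately show ?thesis
    by (simp add: inner_vec_def power2_eq_square)
qed

lemma diag_matrix_sandwich_nth:
  "(P ** diag_matrix x ** R) $ i $ l = (\<Sum>j\<in>UNIV. P $ i $ j * x $ j * R $ j $ l)"
  by (simp add: matrix_matrix_mult_def diag_matrix_def if_distrib[of "\<lambda>z. _ * z"] cong: if_cong)

text \<open>
  The diagonal is \<open>M *v x\<close> with \<open>M i j = P i j * R j i\<close>, where the rows and columns of \<open>P\<close> and \<open>R\<close>
  have norm at most 1; hence \<open>M\<close> is doubly substochastic. This is a form of the trace inequality of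
  von Neumann. It yields below both that \<open>f\<close> takes one value on all singular value vectors of a matrix
  and that the sublevel set of \<open>f \<circ> \<lambda>\<close> is convex.
\<close>

lemma diagonal_in_hull_signed_permutations:
  fixes U U' :: "real^'n^'n" and V V' :: "real^'n^'p"
  assumes U: "transpose U ** U = mat 1" "transpose U' ** U' = mat 1"
    and V: "transpose V ** V = mat 1" "transpose V' ** V' = mat 1"
  shows "(\<chi> i. (transpose U' ** (U ** diag_matrix x ** transpose V) ** V') $ i $ i)
    \<in> convex hull (signed_permutations x)"
proof -
  define P where "P = transpose U' ** U"
  define R where "R = transpose V ** V'"
  have P': "transpose P = transpose U ** U'" and R': "transpose R = transpose V' ** V"
    by (simp_all add: P_def R_def matrix_transpose_mul)
  have col: "(\<Sum>i\<in>UNIV. (P $ i $ j)\<^sup>2) \<le> 1" "(\<Sum>i\<in>UNIV. (R $ i $ j)\<^sup>2) \<le> 1" for j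
    unfolding P_def R_def using U V by (auto intro: sum_sq_transpose_mult_le)
  have "(\<Sum>i\<in>UNIV. ((transpose P) $ i $ j)\<^sup>2) \<le> 1" "(\<Sum>i\<in>UNIV. ((transpose R) $ i $ j)\<^sup>2) \<le> 1" for j
    unfolding P' R' using U V by (auto intro: sum_sq_transpose_mult_le)
  then have row: "(\<Sum>i\<in>UNIV. (P $ j $ i)\<^sup>2) \<le> 1" "(\<Sum>i\<in>UNIV. (R $ j $ i)\<^sup>2) \<le> 1" for j
    by (simp_all add: transpose_def)
  have amgm: "\<bar>a * b\<bar> \<le> (a\<^sup>2 + b\<^sup>2) / 2" for a b :: real
    using sum_squares_bound[of "\<bar>a\<bar>" "\<bar>b\<bar>"] by (simp add: abs_mult)
  have "(\<Sum>j\<in>UNIV. \<bar>P $ i $ j * R $ j $ i\<bar>) \<le> 1" for i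
  proof -
    have "(\<Sum>j\<in>UNIV. \<bar>P $ i $ j * R $ j $ i\<bar>) \<le> (\<Sum>j\<in>UNIV. ((P $ i $ j)\<^sup>2 + (R $ j $ i)\<^sup>2) / 2)"
      by (intro sum_mono amgm)
    then show ?thesis
      using row(1)[of i] col(2)[of i] by (simp add: sum.distrib flip: sum_divide_distrib)
  qed
  moreover have "(\<Sum>i\<in>UNIV. \<bar>P $ i $ j * R $ j $ i\<bar>) \<le> 1" for j
  proof -
    have "(\<Sum>i\<in>UNIV. \<bar>P $ i $ j * R $ j $ i\<bar>) \<le> (\<Sum>i\<in>UNIV. ((P $ i $ j)\<^sup>2 + (R $ j $ i)\<^sup>2) / 2)"
      by (intro sum_mono amgm)
    then show ?thesis
      using row(2)[of j] col(1)[of j] by (simp add: sum.distrib flip: sum_divide_distrib)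
  qed
  ultimately have "(\<chi> i. \<Sum>j\<in>UNIV. (P $ i $ j * R $ j $ i) * x $ j) \<in> convex hull (signed_permutations x)"
    by (rule substochastic_mult_in_hull)
  moreover have "transpose U' ** (U ** diag_matrix x ** transpose V) ** V' = P ** diag_matrix x ** R"
    by (simp add: P_def R_def matrix_mul_assoc)
  ultimately show ?thesis
    by (simp add: diag_matrix_sandwich_nth mult.commute mult.left_commute)
qed

lemma rank_diag_matrix: "rank (diag_matrix s) = card {i. s $ i \<noteq> 0}" for s :: "real^'n"
proof -
  have row: "row i (diag_matrix s) = s $ i *\<^sub>R axis i 1" for i
    by (simp add: row_def diag_matrix_def axis_def vec_eq_iff)
  let ?B = "(\<lambda>i. axis i 1 :: real^'n) ` {i. s $ i \<noteq> 0}"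
  have sub: "rows (diag_matrix s) \<subseteq> span ?B"
  proof
    fix v assume "v \<in> rows (diag_matrix s)"
    then obtain i where "v = s $ i *\<^sub>R axis i 1"
      by (auto simp: rows_def row)
    then show "v \<in> span ?B"
      by (cases "s $ i = 0") (auto intro: span_scale span_base simp: span_zero)
  qed
  have "?B \<subseteq> span (rows (diag_matrix s))"
  proof
    fix v assume "v \<in> ?B"
    then obtain i where i: "s $ i \<noteq> 0" "v = axis i 1" by auto
    have "s $ i *\<^sub>R axis i 1 \<in> span (rows (diag_matrix s))"
      unfolding row[symmetric] by (auto intro!: span_base simp: rows_def)
    then have "(1 / s $ i) *\<^sub>R s $ i *\<^sub>R axis i 1 \<in> span (rows (diag_matrix s))"
      by (rule span_scale)
    then show "v \<in> span (rows (diag_matrix s))"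
      using i by simp
  qed
  with sub have "span ?B = span (rows (diag_matrix s))"
    by (metis span_eq)
  moreover have "independent ?B"
    by (rule pairwise_orthogonal_independent)
      (auto simp: pairwise_def orthogonal_def inner_axis_axis axis_eq_axis axis_eq_0_iff)
  ultimately have "dim (rows (diag_matrix s)) = card ?B"
    by (rule dim_eq_card)
  also have "\<dots> = card {i. s $ i \<noteq> 0}"
    by (intro card_image) (simp add: inj_on_def axis_eq_axis)
  finally show ?thesis by (simp add: row_rank_def)
qed

lemma compression_svd:
  fixes U :: "real^'n^'n" and V :: "real^'n^'p"
  assumes "transpose U ** U = mat 1" "transpose V ** V = mat 1"
  shows "transpose U ** (U ** B ** transpose V) ** V = B"
proof -
  have "transpose U ** (U ** B ** transpose V) ** V = (transpose U ** U) ** B ** (transpose V ** V)"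
    by (simp add: matrix_mul_assoc)
  then show ?thesis by (simp add: assms)
qed

lemma diagonal_diag_matrix [simp]: "(\<chi> i. diag_matrix x $ i $ i) = x"
  by (simp add: diag_matrix_def vec_eq_iff)

lemma rank_svd:
  fixes U :: "real^'n^'n" and V :: "real^'n^'p"
  assumes "transpose U ** U = mat 1" "transpose V ** V = mat 1"
  shows "rank (U ** diag_matrix s ** transpose V) = card {i. s $ i \<noteq> 0}"
proof (rule antisym)
  show "rank (U ** diag_matrix s ** transpose V) \<le> card {i. s $ i \<noteq> 0}"
    unfolding rank_diag_matrix[symmetric] by (meson rank_mul_le_left rank_mul_le_right order_trans)
  have "diag_matrix s = transpose U ** (U ** diag_matrix s ** transpose V) ** V"
    by (simp add: compression_svd[OF assms])
  then show "card {i. s $ i \<noteq> 0} \<le> rank (U ** diag_matrix s ** transpose V)"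
    unfolding rank_diag_matrix[symmetric] by (metis rank_mul_le_left rank_mul_le_right order_trans)
qed

text \<open>
  The vector counterpart of \<open>spectral_domain\<close>: its members are the admissible diagonals in the singular
  value decompositions of members of \<open>spectral_domain k f\<close>.
\<close>

definition sparse_sublevel :: "nat \<Rightarrow> (real^'n \<Rightarrow> real) \<Rightarrow> (real^'n) set" where
  "sparse_sublevel k f = {x. card {i. x $ i \<noteq> 0} \<le> k \<and> f x \<le> 0}"

lemma signed_permutations_invariant:
  assumes f: "permutation_invariant f" "sign_invariant f" and w: "w \<in> signed_permutations x"
  shows "f w = f x" "card {i. w $ i \<noteq> 0} = card {i. x $ i \<noteq> 0}"
proof -
  obtain \<epsilon> \<pi> where \<pi>: "bij \<pi>" and w: "w = (\<chi> i. (if \<epsilon> i then 1 else - 1) * x $ \<pi> i)"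
    using w by (auto simp: signed_permutations_def)
  have "f w = f (\<chi> i. \<bar>w $ i\<bar>)"
    using f(2) unfolding sign_invariant_def by blast
  also have "(\<chi> i. \<bar>w $ i\<bar>) = (\<chi> i. (\<chi> j. \<bar>x $ j\<bar>) $ \<pi> i)"
    by (simp add: w abs_mult vec_eq_iff)
  also have "f \<dots> = f (\<chi> j. \<bar>x $ j\<bar>)"
    using f(1) \<pi> unfolding permutation_invariant_def by blast
  also have "\<dots> = f x"
    using f(2) unfolding sign_invariant_def by metis
  finally show "f w = f x" .
  have "{i. w $ i \<noteq> 0} = \<pi> -` {i. x $ i \<noteq> 0}"
    by (auto simp: w)
  then show "card {i. w $ i \<noteq> 0} = card {i. x $ i \<noteq> 0}"
    using card_vimage_inj[of \<pi> "{i. x $ i \<noteq> 0}"] \<pi> by (simp add: bij_def)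
qed

lemma convex_sublevel:
  assumes "convex_on UNIV f"
  shows "convex {x. f x \<le> (c::real)}"
proof (rule convexI)
  fix x y :: 'a and u v :: real
  assume *: "x \<in> {x. f x \<le> c}" "y \<in> {x. f x \<le> c}" "0 \<le> u" "0 \<le> v" "u + v = 1"
  then have "f (u *\<^sub>R x + v *\<^sub>R y) \<le> u * f x + v * f y"
    using assms unfolding convex_on_def by blast
  also have "\<dots> \<le> c"
    using * by (intro convex_bound_le) auto
  finally show "u *\<^sub>R x + v *\<^sub>R y \<in> {x. f x \<le> c}" by simp
qed

lemma hull_signed_permutations_le:
  assumes "convex_on UNIV f" "permutation_invariant f" "sign_invariant f"
    and "y \<in> convex hull (signed_permutations x)"
  shows "f y \<le> f x"
proof -
  have "convex hull (signed_permutations x) \<subseteq> {z. f z \<le> f x}"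
    using signed_permutations_invariant(1)[OF assms(2,3)] convex_sublevel[OF assms(1)]
    by (intro hull_minimal) auto
  with assms(4) show ?thesis by auto
qed

context
  fixes f :: "real^'n \<Rightarrow> real" and U :: "real^'n^'n" and V :: "real^'n^'p"
  assumes f: "convex_on UNIV f" "permutation_invariant f" "sign_invariant f"
    and UV: "transpose U ** U = mat 1" "transpose V ** V = mat 1"
    and le: "CARD('n) \<le> CARD('p)"
begin

text \<open>
  The entries of \<open>x\<close> may have any sign and order. Each of \<open>x\<close> and the chosen singular values is the
  diagonal of a compression of the same matrix, so each lies in the hull of the signed permutations of
  the other, and \<open>f\<close> takes equal values at them.
\<close>

lemma spectral_function_svd: "f (singular_values (U ** diag_matrix x ** transpose V)) = f x"
proof -
  let ?X = "U ** diag_matrix x ** transpose V"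
  obtain U' V' where *: "transpose U' ** U' = mat 1" "transpose V' ** V' = mat 1"
    and X: "?X = U' ** diag_matrix (singular_values ?X) ** transpose V'"
    using is_singular_values_singular_values[OF le, of ?X]
    unfolding is_singular_values_def orthogonal_matrix by metis
  show ?thesis
  proof (rule antisym)
    show "f (singular_values ?X) \<le> f x"
      using diagonal_in_hull_signed_permutations[OF UV(1) *(1) UV(2) *(2), of x]
      by (subst (asm) X, unfold compression_svd[OF *] diagonal_diag_matrix)
        (rule hull_signed_permutations_le[OF f])
    show "f x \<le> f (singular_values ?X)"
      using diagonal_in_hull_signed_permutations[OF *(1) UV(1) *(2) UV(2), of "singular_values ?X"]
      by (subst (asm) X[symmetric], unfold compression_svd[OF UV] diagonal_diag_matrix)
        (rule hull_signed_permutations_le[OF f])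
  qed
qed

lemma svd_in_spectral_domain_iff:
  "U ** diag_matrix x ** transpose V \<in> spectral_domain k f \<longleftrightarrow> x \<in> sparse_sublevel k f"
  using rank_svd[OF UV] spectral_function_svd by (simp add: spectral_domain_def sparse_sublevel_def)

end

lemma svdE:
  fixes X :: "real^'p^'n"
  assumes "CARD('n) \<le> CARD('p)"
  obtains U :: "real^'n^'n" and V :: "real^'n^'p" and s where
    "transpose U ** U = mat 1" "transpose V ** V = mat 1" "\<forall>i. 0 \<le> s $ i"
    "X = U ** diag_matrix s ** transpose V"
  using is_singular_values_singular_values[OF assms, of X]
  unfolding is_singular_values_def orthogonal_matrix by blast

lemma linear_svd:
  fixes U :: "real^'n^'n" and V :: "real^'n^'p"
  shows "linear (\<lambda>x. U ** diag_matrix x ** transpose V)"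
  by (intro linearI) (simp_all add: vec_eq_iff diag_matrix_sandwich_nth algebra_simps sum.distrib
      sum_distrib_left)

lemma linear_compression_diagonal:
  fixes U :: "real^'n^'n" and V :: "real^'n^'p"
  shows "linear (\<lambda>X :: real^'p^'n. \<chi> i. (transpose U ** X ** V) $ i $ i)"
  by (intro linearI) (simp_all add: vec_eq_iff matrix_matrix_mult_def algebra_simps sum.distrib
      sum_distrib_left sum_distrib_right)

text \<open>
  Reduces membership in the hull to vectors. In one direction the hull is mapped linearly by
  \<open>x \<mapsto> U diag(x) V\<^sup>T\<close>; in the other, reading off the diagonal of \<open>U\<^sup>T Y V\<close> sends every member \<open>Y\<close> of the
  spectral domain into the hull of the signed permutations of its singular values.
\<close>

lemma svd_in_hull_spectral_domain_iff:
  fixes f :: "real^'n \<Rightarrow> real" and U :: "real^'n^'n" and V :: "real^'n^'p"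
  assumes f: "convex_on UNIV f" "permutation_invariant f" "sign_invariant f"
    and UV: "transpose U ** U = mat 1" "transpose V ** V = mat 1"
    and le: "CARD('n) \<le> CARD('p)"
  shows "U ** diag_matrix x ** transpose V \<in> convex hull (spectral_domain k f)
    \<longleftrightarrow> x \<in> convex hull (sparse_sublevel k f)"
proof
  assume "x \<in> convex hull (sparse_sublevel k f)"
  then have "U ** diag_matrix x ** transpose V
      \<in> convex hull ((\<lambda>x. U ** diag_matrix x ** transpose V) ` sparse_sublevel k f)"
    unfolding convex_hull_linear_image[OF linear_svd, symmetric] by (rule imageI)
  moreover have "(\<lambda>x. U ** diag_matrix x ** transpose V) ` sparse_sublevel k f \<subseteq> spectral_domain k f"
    using svd_in_spectral_domain_iff[OF f UV le] by auto
  ultimately show "U ** diag_matrix x ** transpose V \<in> convex hull (spectral_domain k f)"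
    using hull_mono by blast
next
  let ?\<phi> = "\<lambda>X :: real^'p^'n. \<chi> i. (transpose U ** X ** V) $ i $ i"
  have "?\<phi> ` spectral_domain k f \<subseteq> convex hull (sparse_sublevel k f)"
  proof clarify
    fix Y :: "real^'p^'n" assume Y: "Y \<in> spectral_domain k f"
    obtain W :: "real^'n^'n" and Z :: "real^'n^'p" and s where
      WZ: "transpose W ** W = mat 1" "transpose Z ** Z = mat 1" and s: "\<forall>i. 0 \<le> s $ i"
      and Y_eq: "Y = W ** diag_matrix s ** transpose Z"
      by (rule svdE[OF le, of Y])
    have "s \<in> sparse_sublevel k f"
      using Y unfolding Y_eq svd_in_spectral_domain_iff[OF f WZ le] .
    then have "signed_permutations s \<subseteq> sparse_sublevel k f"
      using signed_permutations_invariant[OF f(2,3)] by (auto simp: sparse_sublevel_def)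
    then have "convex hull (signed_permutations s) \<subseteq> convex hull (sparse_sublevel k f)"
      by (rule hull_mono)
    then show "?\<phi> Y \<in> convex hull (sparse_sublevel k f)"
      using diagonal_in_hull_signed_permutations[OF WZ(1) UV(1) WZ(2) UV(2), of s]
      unfolding Y_eq by blast
  qed
  then have "convex hull (?\<phi> ` spectral_domain k f) \<subseteq> convex hull (sparse_sublevel k f)"
    by (simp add: hull_minimal)
  moreover assume "U ** diag_matrix x ** transpose V \<in> convex hull (spectral_domain k f)"
  then have "?\<phi> (U ** diag_matrix x ** transpose V) \<in> convex hull (?\<phi> ` spectral_domain k f)"
    unfolding convex_hull_linear_image[OF linear_compression_diagonal, symmetric] by (rule imageI)
  moreover have "?\<phi> (U ** diag_matrix x ** transpose V) = x"
    by (simp add: compression_svd[OF UV])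
  ultimately show "x \<in> convex hull (sparse_sublevel k f)"
    by auto
qed

text \<open>
  The constraint \<open>f \<le> 0\<close> survives convex combinations; only the rank bound can be lost in the hull.
\<close>

lemma hull_spectral_domain_rank_le:
  fixes f :: "real^'n \<Rightarrow> real" and X :: "real^'p^'n"
  assumes f: "convex_on UNIV f" "permutation_invariant f" "sign_invariant f"
    and le: "CARD('n) \<le> CARD('p)"
    and X: "X \<in> convex hull (spectral_domain k f)" "rank X \<le> r"
  shows "X \<in> spectral_domain r f"
proof -
  obtain U :: "real^'n^'n" and V :: "real^'n^'p" and s where
    UV: "transpose U ** U = mat 1" "transpose V ** V = mat 1" and s: "\<forall>i. 0 \<le> s $ i"
    and X_eq: "X = U ** diag_matrix s ** transpose V"
    by (rule svdE[OF le, of X])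
  have "s \<in> convex hull (sparse_sublevel k f)"
    using X(1) unfolding X_eq svd_in_hull_spectral_domain_iff[OF f UV le] .
  also have "\<dots> \<subseteq> {x. f x \<le> 0}"
    using convex_sublevel[OF f(1)] by (intro hull_minimal) (auto simp: sparse_sublevel_def)
  finally have "s \<in> sparse_sublevel r f"
    using X(2) unfolding X_eq rank_svd[OF UV] by (simp add: sparse_sublevel_def)
  then show ?thesis
    unfolding X_eq svd_in_spectral_domain_iff[OF f UV le] .
qed

section \<open>Directions feasible in both senses\<close>

text \<open>
  For \<open>x\<close> in a convex set \<open>C\<close> this is the linear space parallel to the face of \<open>C\<close> that has \<open>x\<close> in its relative
  interior.
\<close>

definition two_sided_directions :: "'a::real_vector set \<Rightarrow> 'a \<Rightarrow> 'a set" where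
  "two_sided_directions C x = {d. \<exists>t>0. x + t *\<^sub>R d \<in> C \<and> x - t *\<^sub>R d \<in> C}"

lemma two_sided_directionsI:
  assumes C: "convex C" and "0 < a" "0 < b" "x + a *\<^sub>R d \<in> C" "x - b *\<^sub>R d \<in> C"
  shows "d \<in> two_sided_directions C x"
proof -
  have mem: "x + t *\<^sub>R d \<in> C" if "- b \<le> t" "t \<le> a" for t
  proof -
    define \<theta> where "\<theta> = (t + b) / (a + b)"
    have "\<theta> * (a + b) = t + b"
      using assms(2,3) by (simp add: \<theta>_def)
    moreover have "0 \<le> \<theta>" "0 \<le> 1 - \<theta>"
      using assms(2,3) that by (auto simp: \<theta>_def field_simps)
    ultimately have \<theta>: "0 \<le> \<theta>" "0 \<le> 1 - \<theta>" "\<theta> * a - (1 - \<theta>) * b = t"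
      by (auto simp: algebra_simps)
    have "\<theta> *\<^sub>R (x + a *\<^sub>R d) + (1 - \<theta>) *\<^sub>R (x - b *\<^sub>R d) = x + (\<theta> * a - (1 - \<theta>) * b) *\<^sub>R d"
      by (simp add: algebra_simps)
    then show ?thesis
      using convexD[OF C assms(4,5) \<theta>(1,2)] \<theta>(3) by simp
  qed
  have "x + min a b *\<^sub>R d \<in> C" "x + (- min a b) *\<^sub>R d \<in> C"
    using assms(2,3) by (intro mem; simp)+
  then show ?thesis
    unfolding two_sided_directions_def using assms(2,3) by (auto intro!: exI[of _ "min a b"])
qed

lemma subspace_two_sided_directions:
  assumes C: "convex C" "x \<in> C"
  shows "subspace (two_sided_directions C x)"
  unfolding subspace_def
proof (intro conjI ballI allI)
  show "0 \<in> two_sided_directions C x"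
    using C by (intro two_sided_directionsI[of C 1 1]) auto
next
  fix d e assume "d \<in> two_sided_directions C x" "e \<in> two_sided_directions C x"
  then obtain s t where s: "0 < s" "x + s *\<^sub>R d \<in> C" "x - s *\<^sub>R d \<in> C"
    and t: "0 < t" "x + t *\<^sub>R e \<in> C" "x - t *\<^sub>R e \<in> C"
    by (auto simp: two_sided_directions_def)
  define \<theta> where "\<theta> = t / (s + t)"
  have \<theta>: "0 \<le> \<theta>" "0 \<le> 1 - \<theta>" "(1 - \<theta>) * t = \<theta> * s" "0 < \<theta> * s"
    using s(1) t(1) by (auto simp: \<theta>_def field_simps)
  have "\<theta> *\<^sub>R (x + s *\<^sub>R d) + (1 - \<theta>) *\<^sub>R (x + t *\<^sub>R e) = x + ((\<theta> * s) *\<^sub>R d + ((1 - \<theta>) * t) *\<^sub>R e)"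
    "\<theta> *\<^sub>R (x - s *\<^sub>R d) + (1 - \<theta>) *\<^sub>R (x - t *\<^sub>R e) = x - ((\<theta> * s) *\<^sub>R d + ((1 - \<theta>) * t) *\<^sub>R e)"
    by (simp_all add: algebra_simps)
  note eqs = this[unfolded \<theta>(3) scaleR_add_right[symmetric]]
  have "x + (\<theta> * s) *\<^sub>R (d + e) \<in> C" "x - (\<theta> * s) *\<^sub>R (d + e) \<in> C"
    using convexD[OF C(1) s(2) t(2) \<theta>(1,2)] convexD[OF C(1) s(3) t(3) \<theta>(1,2)]
    unfolding eqs by simp_all
  then show "d + e \<in> two_sided_directions C x"
    using \<theta>(4) by (intro two_sided_directionsI[OF C(1)])
next
  fix c :: real and d assume "d \<in> two_sided_directions C x"
  then obtain t where t: "0 < t" "x + t *\<^sub>R d \<in> C" "x - t *\<^sub>R d \<in> C"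
    by (auto simp: two_sided_directions_def)
  consider "c = 0" | "c > 0" | "c < 0" by linarith
  then show "c *\<^sub>R d \<in> two_sided_directions C x"
  proof cases
    case 1
    then show ?thesis using C by (intro two_sided_directionsI[of C 1 1]) auto
  next
    case 2
    then show ?thesis using t by (intro two_sided_directionsI[OF C(1), of "t / c" "t / c"]) auto
  next
    case 3
    then show ?thesis
      using t by (intro two_sided_directionsI[OF C(1), of "t / - c" "t / - c"])
        (auto intro: divide_pos_neg)
  qed
qed

section \<open>Transfers between coordinates\<close>

text \<open>
  Interchanging entries \<open>i\<close> and \<open>j\<close> of the single term \<open>x\<close> keeps it in \<open>E\<close> and moves the convex
  combination a positive distance along \<open>axis j 1 - axis i 1\<close>.
\<close>

lemma convex_hull_exchange:
  fixes E :: "(real^'n) set"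
  assumes F: "finite F" "F \<subseteq> E" "\<forall>x\<in>F. 0 \<le> u x" "sum u F = 1"
    and perm: "\<And>x \<pi>. x \<in> E \<Longrightarrow> bij \<pi> \<Longrightarrow> (\<chi> l. x $ \<pi> l) \<in> E"
    and x: "x \<in> F" "0 < u x" "x $ j < x $ i"
  shows "\<exists>\<epsilon>>0. (\<Sum>v\<in>F. u v *\<^sub>R v) + \<epsilon> *\<^sub>R (axis j 1 - axis i 1) \<in> convex hull E"
proof -
  have "i \<noteq> j" using x(3) by auto
  define \<pi> where "\<pi> = id(i := j, j := i)"
  define y where "y = (\<chi> l. x $ \<pi> l)"
  have "bij \<pi>"
    by (rule involuntory_imp_bij) (auto simp: \<pi>_def)
  then have "y \<in> E"
    unfolding y_def using perm x(1) F(2) by blast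
  have yx: "y - x = (x $ i - x $ j) *\<^sub>R (axis j 1 - axis i 1)"
    using \<open>i \<noteq> j\<close> by (auto simp: y_def \<pi>_def vec_eq_iff axis_def)
  have "(\<Sum>v\<in>F. u v *\<^sub>R (if v = x then y else v)) \<in> convex hull E"
    using F \<open>y \<in> E\<close> by (intro convex_sum) (auto intro: hull_inc)
  also have "(\<Sum>v\<in>F. u v *\<^sub>R (if v = x then y else v))
      = (\<Sum>v\<in>F. u v *\<^sub>R v + (if v = x then u x *\<^sub>R (y - x) else 0))"
    by (intro sum.cong) (auto simp: algebra_simps)
  also have "\<dots> = (\<Sum>v\<in>F. u v *\<^sub>R v) + (u x * (x $ i - x $ j)) *\<^sub>R (axis j 1 - axis i 1)"
    using F(1) x(1) by (simp add: sum.distrib yx)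
  finally show ?thesis
    using x(2,3) by (intro exI[of _ "u x * (x $ i - x $ j)"]) simp
qed

text \<open>
  Let \<open>i0\<close> be a position of the smallest nonzero entry of \<open>\<mu>\<close> and \<open>x0\<close> a term of a convex combination for
  \<open>\<mu>\<close> with \<open>x0 $ i0 > 0\<close>. As \<open>x0\<close> is sparse, it vanishes at many positions \<open>j\<close> of the support of \<open>\<mu>\<close>. The
  term \<open>x0\<close> allows a transfer from \<open>i0\<close> to such a \<open>j\<close>. Since \<open>\<mu> $ i0 \<le> \<mu> $ j\<close> although \<open>x0\<close> favours
  \<open>i0\<close>, some other term must favour \<open>j\<close>, and it allows the transfer back. So \<open>i0\<close> and these \<open>j\<close> form \<open>J\<close>.
\<close>

lemma exchangeable_coordinates:
  fixes E :: "(real^'n) set"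
  assumes perm: "\<And>x \<pi>. x \<in> E \<Longrightarrow> bij \<pi> \<Longrightarrow> (\<chi> l. x $ \<pi> l) \<in> E"
    and sparse: "\<And>x. x \<in> E \<Longrightarrow> card {l. x $ l \<noteq> 0} \<le> r"
    and \<mu>: "\<mu> \<in> convex hull E" "\<forall>i. 0 \<le> \<mu> $ i"
    and k: "k < card {i. \<mu> $ i \<noteq> 0}"
  obtains J where "k + 2 \<le> card J + r" "J \<noteq> {}"
    "\<And>i j. i \<in> J \<Longrightarrow> j \<in> J \<Longrightarrow> axis i 1 - axis j 1 \<in> two_sided_directions (convex hull E) \<mu>"
proof -
  let ?G = "two_sided_directions (convex hull E) \<mu>"
  obtain F u where F: "finite F" "F \<subseteq> E" "\<forall>x\<in>F. 0 \<le> u x" "sum u F = 1"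
    and \<mu>_eq: "(\<Sum>v\<in>F. u v *\<^sub>R v) = \<mu>"
    using \<mu>(1) unfolding convex_hull_explicit by blast
  have \<mu>_nth: "\<mu> $ i = (\<Sum>v\<in>F. u v * v $ i)" for i
    by (simp add: \<mu>_eq[symmetric])
  have exch: "\<exists>\<epsilon>>0. \<mu> + \<epsilon> *\<^sub>R (axis j 1 - axis i 1) \<in> convex hull E"
    if "x \<in> F" "0 < u x" "x $ j < x $ i" for x i j
    using convex_hull_exchange[OF F perm that] \<mu>_eq by simp
  define S where "S = {i. \<mu> $ i \<noteq> 0}"
  have "0 < card S"
    using k by (simp add: S_def)
  then have S: "finite S" "S \<noteq> {}"
    by (auto simp: card_gt_0_iff)
  have "Min ((\<lambda>i. \<mu> $ i) ` S) \<in> (\<lambda>i. \<mu> $ i) ` S"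
    using S by (intro Min_in) auto
  then obtain i0 where "i0 \<in> S" and eq: "Min ((\<lambda>i. \<mu> $ i) ` S) = \<mu> $ i0"
    by (rule imageE)
  have i0_min: "\<mu> $ i0 \<le> \<mu> $ j" if "j \<in> S" for j
    unfolding eq[symmetric] using S(1) that by (intro Min_le) auto
  have "0 < \<mu> $ i0"
    using \<open>i0 \<in> S\<close> \<mu>(2) by (simp add: S_def order_less_le)
  then have "\<not> (\<forall>x\<in>F. u x * x $ i0 \<le> 0)"
    unfolding \<mu>_nth using sum_nonpos[of F "\<lambda>x. u x * x $ i0"] by fastforce
  then obtain x0 where x0: "x0 \<in> F" "0 < u x0 * x0 $ i0"
    by (auto simp: not_le)
  have x0pos: "0 < u x0" "0 < x0 $ i0"
    using x0 F(3) by (auto simp: zero_less_mult_iff)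
  define Z where "Z = {j \<in> S. x0 $ j = 0}"
  have "i0 \<notin> Z"
    using x0pos by (simp add: Z_def)
  have "S \<subseteq> Z \<union> {l. x0 $ l \<noteq> 0}"
    by (auto simp: Z_def)
  then have "card S \<le> card (Z \<union> {l. x0 $ l \<noteq> 0})"
    by (intro card_mono) auto
  also have "\<dots> \<le> card Z + card {l. x0 $ l \<noteq> 0}"
    by (rule card_Un_le)
  also have "\<dots> \<le> card Z + r"
    using sparse x0(1) F(2) by auto
  finally have card: "k + 2 \<le> card (insert i0 Z) + r"
    using k \<open>i0 \<notin> Z\<close> by (simp add: S_def[symmetric])
  have dir: "axis i0 1 - axis j 1 \<in> ?G" if "j \<in> Z" for j
  proof -
    have j: "j \<in> S" "x0 $ j < x0 $ i0"
      using that x0pos by (auto simp: Z_def)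
    obtain b where b: "0 < b" "\<mu> + b *\<^sub>R (axis j 1 - axis i0 1) \<in> convex hull E"
      using exch[OF x0(1) x0pos(1) j(2)] by blast
    have "\<exists>x\<in>F. 0 < u x \<and> x $ i0 < x $ j"
    proof (rule ccontr)
      assume no: "\<not> ?thesis"
      have "\<mu> $ j < \<mu> $ i0"
        unfolding \<mu>_nth
      proof (rule sum_strict_mono_ex1)
        show "\<forall>x\<in>F. u x * x $ j \<le> u x * x $ i0"
        proof
          fix x assume "x \<in> F"
          then show "u x * x $ j \<le> u x * x $ i0"
            using no F(3) by (cases "u x = 0") (auto simp: order_less_le intro!: mult_left_mono)
        qed
        show "\<exists>x\<in>F. u x * x $ j < u x * x $ i0"
          using x0(1) x0pos(1) j(2) by (intro bexI[of _ x0]) auto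
      qed (rule F(1))
      with i0_min[OF j(1)] show False by simp
    qed
    then obtain a where a: "0 < a" "\<mu> + a *\<^sub>R (axis i0 1 - axis j 1) \<in> convex hull E"
      using exch by blast
    have "\<mu> - b *\<^sub>R (axis i0 1 - axis j 1) \<in> convex hull E"
      using b(2) by (simp add: algebra_simps)
    with a b(1) show ?thesis
      by (intro two_sided_directionsI[of _ a b]) auto
  qed
  have G: "subspace ?G"
    by (intro subspace_two_sided_directions \<mu>) simp
  have dir': "axis i0 1 - axis j 1 \<in> ?G" if "j \<in> insert i0 Z" for j
    using that dir subspace_0[OF G] by auto
  have "axis i 1 - axis j 1 \<in> ?G" if "i \<in> insert i0 Z" "j \<in> insert i0 Z" for i j
    using subspace_diff[OF G dir'[OF that(2)] dir'[OF that(1)]] by simp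
  then show ?thesis
    using card by (intro that[of "insert i0 Z"]) auto
qed

section \<open>From transfers to symmetric blocks\<close>

text \<open>
  For \<open>p = {i, j}\<close> this is the symmetric matrix unit at \<open>i\<close>, \<open>j\<close>, a diagonal unit if \<open>i = j\<close>. Indexing
  by sets counts every unordered pair once.
\<close>

definition pair_matrix :: "'n set \<Rightarrow> real^'n^'n" where
  "pair_matrix p = (\<chi> a b. if {a, b} = p then 1 else 0)"

text \<open>
  A rotation by 45 degrees in the plane of coordinates \<open>i\<close> and \<open>j\<close>, with orientation \<open>\<sigma>\<close>, replaces the two
  entries of \<open>\<nu>\<close> by their mean and puts half their difference off the diagonal.
\<close>

lemma diag_matrix_rotated_45_degrees:
  fixes \<nu> :: "real^'n"
  assumes "i \<noteq> j" and \<sigma>: "\<sigma> = 1 \<or> \<sigma> = - 1"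
  obtains W :: "real^'n^'n" where "transpose W ** W = mat 1"
    "W ** diag_matrix \<nu> ** transpose W
      = diag_matrix (\<chi> l. if l = i \<or> l = j then (\<nu> $ i + \<nu> $ j) / 2 else \<nu> $ l)
        + (\<sigma> * (\<nu> $ i - \<nu> $ j) / 2) *\<^sub>R pair_matrix {i, j}"
proof -
  define \<delta> :: "'n \<Rightarrow> 'n \<Rightarrow> real" where "\<delta> a b = (if a = b then 1 else 0)" for a b
  define W :: "real^'n^'n" where
    "W = (\<chi> a b. if b = i then (\<delta> a i + \<sigma> * \<delta> a j) / sqrt 2
                else if b = j then (\<delta> a j - \<sigma> * \<delta> a i) / sqrt 2 else \<delta> a b)"
  have entry: "(W ** diag_matrix \<nu> ** transpose W) $ a $ c =
    (\<delta> a i + \<sigma> * \<delta> a j) * (\<delta> c i + \<sigma> * \<delta> c j) * \<nu> $ i / 2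
    + (\<delta> a j - \<sigma> * \<delta> a i) * (\<delta> c j - \<sigma> * \<delta> c i) * \<nu> $ j / 2
    + (if a = c \<and> a \<noteq> i \<and> a \<noteq> j then \<nu> $ a else 0)" for a c and \<nu> :: "real^'n"
  proof -
    let ?g = "\<lambda>b. W $ a $ b * \<nu> $ b * W $ c $ b"
    have "UNIV = insert i (insert j (UNIV - {i, j}))" by auto
    then have "sum ?g UNIV = sum ?g (insert i (insert j (UNIV - {i, j})))" by simp
    also have "\<dots> = ?g i + ?g j + sum ?g (UNIV - {i, j})"
      using assms(1) by (simp add: algebra_simps)
    also have "sum ?g (UNIV - {i, j}) = (\<Sum>b\<in>UNIV - {i, j}. if b = a then (if a = c then \<nu> $ a else 0) else 0)"
      by (intro sum.cong) (auto simp: W_def \<delta>_def)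
    also have "\<dots> = (if a = c \<and> a \<noteq> i \<and> a \<noteq> j then \<nu> $ a else 0)"
      by (auto simp: sum.delta)
    also have "?g i = (\<delta> a i + \<sigma> * \<delta> a j) * (\<delta> c i + \<sigma> * \<delta> c j) * \<nu> $ i / 2"
      by (simp add: W_def)
    also have "?g j = (\<delta> a j - \<sigma> * \<delta> a i) * (\<delta> c j - \<sigma> * \<delta> c i) * \<nu> $ j / 2"
      using assms(1) by (simp add: W_def)
    finally show ?thesis
      by (simp add: diag_matrix_sandwich_nth transpose_def)
  qed
  have "(W ** diag_matrix 1 ** transpose W) = mat 1"
    unfolding vec_eq_iff entry using assms by (auto simp: mat_def \<delta>_def)
  moreover have "diag_matrix 1 = (mat 1 :: real^'n^'n)"
    by (simp add: diag_matrix_def mat_def vec_eq_iff)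
  ultimately have "W ** transpose W = mat 1" by simp
  then have 1: "transpose W ** W = mat 1"
    by (simp add: matrix_left_right_inverse)
  have "W ** diag_matrix \<nu> ** transpose W
      = diag_matrix (\<chi> l. if l = i \<or> l = j then (\<nu> $ i + \<nu> $ j) / 2 else \<nu> $ l)
        + (\<sigma> * (\<nu> $ i - \<nu> $ j) / 2) *\<^sub>R pair_matrix {i, j}"
    unfolding vec_eq_iff entry using assms
    by (auto simp: \<delta>_def diag_matrix_def pair_matrix_def doubleton_eq_iff field_simps)
  with 1 show ?thesis by (rule that)
qed

text \<open>
  Here \<open>K\<close> is a set of diagonals, and \<open>C\<close> a convex set of matrices containing
  all orthogonal conjugates of diagonals in \<open>K\<close>. Two-sided transfers in \<open>K\<close> at \<open>\<mu>\<close> are to be turned into two-sided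
  directions of \<open>C\<close> at \<open>diag_matrix \<mu>\<close>.
\<close>

context
  fixes K :: "(real^'n) set" and C :: "(real^'n^'n) set" and \<mu> :: "real^'n"
  assumes K: "\<mu> \<in> K" and C: "convex C"
    and conj: "\<And>W \<nu>. transpose W ** W = mat 1 \<Longrightarrow> \<nu> \<in> K \<Longrightarrow> W ** diag_matrix \<nu> ** transpose W \<in> C"
begin

lemma diag_matrix_in: "\<nu> \<in> K \<Longrightarrow> diag_matrix \<nu> \<in> C"
  using conj[of "mat 1" \<nu>] by simp

lemma diagonal_direction:
  assumes "axis i 1 - axis j 1 \<in> two_sided_directions K \<mu>"
  shows "pair_matrix {i} - pair_matrix {j} \<in> two_sided_directions C (diag_matrix \<mu>)"
proof -
  obtain t where t: "0 < t" "\<mu> + t *\<^sub>R (axis i 1 - axis j 1) \<in> K" "\<mu> - t *\<^sub>R (axis i 1 - axis j 1) \<in> K"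
    using assms by (auto simp: two_sided_directions_def)
  have "diag_matrix (\<mu> + t *\<^sub>R (axis i 1 - axis j 1)) = diag_matrix \<mu> + t *\<^sub>R (pair_matrix {i} - pair_matrix {j})"
    "diag_matrix (\<mu> - t *\<^sub>R (axis i 1 - axis j 1)) = diag_matrix \<mu> - t *\<^sub>R (pair_matrix {i} - pair_matrix {j})"
    by (auto simp: vec_eq_iff diag_matrix_def pair_matrix_def axis_def)
  then show ?thesis
    using t diag_matrix_in by (intro two_sided_directionsI[OF C t(1) t(1)]) metis+
qed

text \<open>
  Spread the entries \<open>i\<close> and \<open>j\<close> of \<open>\<mu>\<close> apart to get \<open>\<nu> \<in> K\<close>. In the plane of symmetric blocks with
  fixed trace, \<open>diag_matrix \<nu>\<close> and its two rotations by 45 degrees span a triangle around \<open>diag_matrix \<mu>\<close>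
  that contains a segment through it in the off-diagonal direction. If the two entries of \<open>\<mu>\<close> agree,
  \<open>diag_matrix \<mu>\<close> is the midpoint of the two rotations.
\<close>

lemma off_diagonal_direction_aux:
  assumes "i \<noteq> j" and dir: "axis i 1 - axis j 1 \<in> two_sided_directions K \<mu>" and le: "\<mu> $ j \<le> \<mu> $ i"
  shows "pair_matrix {i, j} \<in> two_sided_directions C (diag_matrix \<mu>)"
proof -
  obtain t where t: "0 < t" "\<mu> + t *\<^sub>R (axis i 1 - axis j 1) \<in> K"
    using dir by (auto simp: two_sided_directions_def)
  define \<nu> where "\<nu> = \<mu> + t *\<^sub>R (axis i 1 - axis j 1)"
  define m \<rho> where "m = (\<mu> $ i + \<mu> $ j) / 2" and "\<rho> = (\<mu> $ i - \<mu> $ j) / 2 + t"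
  have \<nu>: "\<nu> $ i = m + \<rho>" "\<nu> $ j = m - \<rho>" "\<And>l. l \<noteq> i \<Longrightarrow> l \<noteq> j \<Longrightarrow> \<nu> $ l = \<mu> $ l"
    using assms(1) by (auto simp: \<nu>_def m_def \<rho>_def axis_def field_simps)
  \<comment> \<open>The share of \<open>diag_matrix \<nu>\<close> that restores the diagonal of \<open>diag_matrix \<mu>\<close>; then the off-diagonal
    entry is exactly \<open>t\<close>.\<close>
  define \<theta> where "\<theta> = (\<rho> - t) / \<rho>"
  have "\<rho> > 0" using t(1) le by (auto simp: \<rho>_def intro!: add_nonneg_pos)
  then have \<theta>: "0 \<le> \<theta>" "\<theta> \<le> 1" "\<theta> * \<rho> = (\<mu> $ i - \<mu> $ j) / 2"
    using t(1) le \<open>\<rho> > 0\<close> by (simp_all add: \<theta>_def) (simp_all add: \<rho>_def)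
  have ends: "m + \<theta> * \<rho> = \<mu> $ i" "m - \<theta> * \<rho> = \<mu> $ j" "(1 - \<theta>) * \<rho> = t"
    using \<theta>(3) by (simp_all add: m_def algebra_simps) (simp_all add: \<rho>_def field_simps)
  have mem: "diag_matrix \<mu> + (\<sigma> * t) *\<^sub>R pair_matrix {i, j} \<in> C" if \<sigma>: "\<sigma> = 1 \<or> \<sigma> = - 1" for \<sigma> :: real
  proof -
    obtain W :: "real^'n^'n" where W: "transpose W ** W = mat 1"
      and W_eq: "W ** diag_matrix \<nu> ** transpose W
      = diag_matrix (\<chi> l. if l = i \<or> l = j then (\<nu> $ i + \<nu> $ j) / 2 else \<nu> $ l)
        + (\<sigma> * (\<nu> $ i - \<nu> $ j) / 2) *\<^sub>R pair_matrix {i, j}"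
      by (rule diag_matrix_rotated_45_degrees[OF assms(1) \<sigma>])
    have "(\<nu> $ i + \<nu> $ j) / 2 = m" "\<sigma> * (\<nu> $ i - \<nu> $ j) / 2 = \<sigma> * \<rho>"
      by (simp_all add: \<nu>)
    from W_eq[unfolded this] have W_eq': "W ** diag_matrix \<nu> ** transpose W
      = diag_matrix (\<chi> l. if l = i \<or> l = j then m else \<nu> $ l) + (\<sigma> * \<rho>) *\<^sub>R pair_matrix {i, j}"
      .
    have "\<nu> \<in> K" using t(2) by (simp add: \<nu>_def)
    then have "(1 - \<theta>) *\<^sub>R (W ** diag_matrix \<nu> ** transpose W) + \<theta> *\<^sub>R diag_matrix \<nu> \<in> C"
      using convexD[OF C conj[OF W] diag_matrix_in] \<theta> by simp
    also have "(1 - \<theta>) *\<^sub>R (W ** diag_matrix \<nu> ** transpose W) + \<theta> *\<^sub>R diag_matrix \<nu>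
      = diag_matrix \<mu> + (\<sigma> * ((1 - \<theta>) * \<rho>)) *\<^sub>R pair_matrix {i, j}"
      unfolding W_eq' vec_eq_iff using assms(1) \<nu>
      by (auto simp: diag_matrix_def pair_matrix_def doubleton_eq_iff ends(1,2)[symmetric] algebra_simps)
    finally show ?thesis
      by (simp add: ends(3))
  qed
  show ?thesis
    using mem[of 1] mem[of "- 1"] by (intro two_sided_directionsI[OF C t(1) t(1)]) auto
qed

lemma off_diagonal_direction:
  assumes "i \<noteq> j" and "axis i 1 - axis j 1 \<in> two_sided_directions K \<mu>"
    "axis j 1 - axis i 1 \<in> two_sided_directions K \<mu>"
  shows "pair_matrix {i, j} \<in> two_sided_directions C (diag_matrix \<mu>)"
  using off_diagonal_direction_aux[of i j] off_diagonal_direction_aux[of j i] assms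
  by (cases "\<mu> $ j \<le> \<mu> $ i") (auto simp: insert_commute)

text \<open>
  The two-sided directions form a subspace, so it is enough to treat generators. Subtracting the
  multiple of \<open>pair_matrix {i0}\<close> that cancels the trace is linear and maps each generator of the symmetric
  block \<open>J\<close> to a direction obtained above.
\<close>

lemma traceless_block_direction:
  assumes J: "\<And>i j. i \<in> J \<Longrightarrow> j \<in> J \<Longrightarrow> axis i 1 - axis j 1 \<in> two_sided_directions K \<mu>" "J \<noteq> {}"
    and d: "d \<in> span (pair_matrix ` {p. p \<subseteq> J \<and> card p \<in> {1, 2}})" "mat 1 \<bullet> d = 0"
  shows "d \<in> two_sided_directions C (diag_matrix \<mu>)"
proof -
  let ?G = "two_sided_directions C (diag_matrix \<mu>)"
  obtain i0 where i0: "i0 \<in> J" using J(2) by auto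
  have G: "subspace ?G"
    using K diag_matrix_in by (intro subspace_two_sided_directions C) auto
  have inner1: "mat 1 \<bullet> pair_matrix {i} = 1" for i :: 'n
    by (simp add: inner_vec_def mat_def pair_matrix_def if_distrib[of "\<lambda>z. z * _"] cong: if_cong)
  have inner2: "mat 1 \<bullet> pair_matrix {i, j} = 0" if "i \<noteq> j" for i j :: 'n
    using that by (auto simp: inner_vec_def mat_def pair_matrix_def intro!: sum.neutral)
  let ?h = "\<lambda>d :: real^'n^'n. d - (mat 1 \<bullet> d) *\<^sub>R pair_matrix {i0}"
  have "linear ?h"
    by (intro linearI) (simp_all add: inner_add algebra_simps)
  then have "subspace (?h -` ?G)"
    using G by (rule linear_subspace_vimage)
  moreover have h: "?h (pair_matrix p) \<in> ?G" if "p \<subseteq> J" "card p = 1 \<or> card p = 2" for p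
    using that(2)
  proof
    assume "card p = 1"
    then obtain i where "p = {i}" by (auto simp: card_1_singleton_iff)
    then show ?thesis
      using that(1) i0 by (simp add: inner1 diagonal_direction J(1))
  next
    assume "card p = 2"
    then obtain i j where "p = {i, j}" "i \<noteq> j" by (auto simp: card_2_iff)
    then show ?thesis
      using that(1) by (simp add: inner2 off_diagonal_direction J(1))
  qed
  have "pair_matrix ` {p. p \<subseteq> J \<and> card p \<in> {1, 2}} \<subseteq> ?h -` ?G"
    using h by (intro image_subsetI vimageI2) auto
  ultimately have "span (pair_matrix ` {p. p \<subseteq> J \<and> card p \<in> {1, 2}}) \<subseteq> ?h -` ?G"
    by (intro span_minimal)
  then have "?h d \<in> ?G"
    using d(1) by (auto simp only: subset_iff vimage_eq)
  with d(2) show ?thesis by simp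
qed

end

lemma dim_pair_matrices:
  fixes J :: "'n::finite set"
  shows "2 * dim (span (pair_matrix ` {p. p \<subseteq> J \<and> card p \<in> {1, 2}})) = card J * (card J + 1)"
proof -
  let ?P = "{p. p \<subseteq> J \<and> card p \<in> {1, 2}}"
  have rep: "\<exists>a b. p = {a, b}" if "p \<in> ?P" for p
    using that by (auto simp: card_1_singleton_iff card_2_iff) 
  have inj: "inj_on pair_matrix ?P"
  proof (rule inj_onI)
    fix p q assume p: "p \<in> ?P" and eq: "pair_matrix p = pair_matrix q"
    obtain a b where ab: "p = {a, b}" using rep[OF p] by blast
    then have "pair_matrix p $ a $ b = 1" by (simp add: pair_matrix_def)
    then show "p = q"
      unfolding eq using ab by (auto simp: pair_matrix_def split: if_splits)
  qed
  have "independent (pair_matrix ` ?P)"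
  proof (rule pairwise_orthogonal_independent)
    have "pair_matrix p \<bullet> pair_matrix q = 0" if "pair_matrix p \<noteq> pair_matrix q" for p q :: "'n set"
      using that by (auto simp: inner_vec_def pair_matrix_def intro!: sum.neutral split: if_splits)
    then show "pairwise orthogonal (pair_matrix ` ?P)"
      by (auto simp: pairwise_def orthogonal_def)
    show "0 \<notin> pair_matrix ` ?P"
    proof
      assume "0 \<in> pair_matrix ` ?P"
      then obtain p where p: "0 = pair_matrix p" "p \<in> ?P" by (rule imageE)
      obtain a b where "p = {a, b}" using rep[OF p(2)] by blast
      then have "pair_matrix p $ a $ b = 1" by (simp add: pair_matrix_def)
      then show False by (simp flip: p(1))
    qed
  qed
  then have "dim (span (pair_matrix ` ?P)) = card (pair_matrix ` ?P)"
    unfolding dim_span by (rule dim_eq_card_independent)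
  also have "\<dots> = card ?P"
    by (rule card_image[OF inj])
  also have "card ?P = card ({p. p \<subseteq> J \<and> card p = 1} \<union> {p. p \<subseteq> J \<and> card p = 2})"
    by (rule arg_cong[of _ _ card]) auto
  also have "\<dots> = card {p. p \<subseteq> J \<and> card p = 1} + card {p. p \<subseteq> J \<and> card p = 2}"
    by (intro card_Un_disjoint) auto
  also have "\<dots> = card J + card J * (card J - 1) div 2"
    by (simp add: n_subsets choose_two)
  finally have dim: "dim (span (pair_matrix ` ?P)) = card J + card J * (card J - 1) div 2" .
  have "2 * (card J + card J * (card J - 1) div 2) = card J * (card J + 1)"
    by (cases "card J") auto
  then show ?thesis
    unfolding dim .
qed

lemma exists_nonzero_orthogonal_in_subspace:
  fixes S T :: "'a::euclidean_space set"
  assumes T: "subspace T" and lt: "dim S < dim T"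
  obtains d where "d \<in> T" "d \<noteq> 0" "\<And>s. s \<in> S \<Longrightarrow> s \<bullet> d = 0"
proof -
  define N where "N = {y \<in> UNIV. \<forall>x\<in>span S. orthogonal x y}"
  have N: "subspace N"
    unfolding N_def by (auto simp: subspace_def orthogonal_def inner_add)
  have "dim N + dim S = DIM('a)"
    using dim_subspace_orthogonal_to_vectors[of "span S" UNIV] by (simp add: N_def)
  moreover have "dim {x + y |x y. x \<in> T \<and> y \<in> N} + dim (T \<inter> N) = dim T + dim N"
    using T N by (rule dim_sums_Int)
  moreover have "dim {x + y |x y. x \<in> T \<and> y \<in> N} \<le> DIM('a)"
    by (rule dim_subset_UNIV)
  ultimately have "dim (T \<inter> N) \<noteq> 0"
    using lt by linarith
  then obtain d where "d \<in> T \<inter> N" "d \<noteq> 0"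
    by auto
  then show ?thesis
    by (intro that) (auto simp: N_def orthogonal_def span_base)
qed

section \<open>Faces through points of high rank\<close>

lemma inner_matrix_mult_left:
  fixes A :: "real^'c^'a" and P :: "real^'b^'a" and B :: "real^'c^'b"
  shows "A \<bullet> (P ** B) = (transpose P ** A) \<bullet> B"
proof -
  have "A \<bullet> (P ** B) = (\<Sum>i\<in>UNIV. \<Sum>j\<in>UNIV. \<Sum>k\<in>UNIV. A $ i $ j * P $ i $ k * B $ k $ j)"
    by (simp add: inner_vec_def matrix_matrix_mult_def sum_distrib_left mult.assoc)
  also have "\<dots> = (\<Sum>i\<in>UNIV. \<Sum>k\<in>UNIV. \<Sum>j\<in>UNIV. A $ i $ j * P $ i $ k * B $ k $ j)"
    by (intro sum.cong refl sum.swap)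
  also have "\<dots> = (\<Sum>k\<in>UNIV. \<Sum>i\<in>UNIV. \<Sum>j\<in>UNIV. A $ i $ j * P $ i $ k * B $ k $ j)"
    by (rule sum.swap)
  also have "\<dots> = (\<Sum>k\<in>UNIV. \<Sum>j\<in>UNIV. \<Sum>i\<in>UNIV. A $ i $ j * P $ i $ k * B $ k $ j)"
    by (intro sum.cong refl sum.swap)
  also have "\<dots> = (transpose P ** A) \<bullet> B"
    by (simp add: inner_vec_def matrix_matrix_mult_def transpose_def sum_distrib_right
        sum_distrib_left mult_ac)
  finally show ?thesis .
qed

lemma inner_transpose: "transpose A \<bullet> transpose B = A \<bullet> B" for A B :: "real^'a^'b"
  unfolding inner_vec_def transpose_def by (simp, rule sum.swap)

lemma inner_sandwich:
  fixes P :: "real^'b^'a" and R :: "real^'d^'c"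
  shows "A \<bullet> (P ** M ** R) = (transpose P ** A ** transpose R) \<bullet> M"
proof -
  have "A \<bullet> (P ** M ** R) = transpose A \<bullet> (transpose R ** transpose (P ** M))"
    unfolding matrix_transpose_mul[symmetric] inner_transpose ..
  also have "\<dots> = transpose (A ** transpose R) \<bullet> transpose (P ** M)"
    by (simp add: inner_matrix_mult_left matrix_transpose_mul)
  also have "\<dots> = (transpose P ** A ** transpose R) \<bullet> M"
    by (simp add: inner_transpose inner_matrix_mult_left matrix_mul_assoc)
  finally show ?thesis .
qed

lemma linear_sandwich:
  fixes P :: "real^'b^'a" and R :: "real^'d^'c"
  shows "linear (\<lambda>M. P ** M ** R)"
  by (intro linearI)
    (simp_all add: vec_eq_iff matrix_matrix_mult_def sum.distrib sum_distrib_left sum_distrib_right algebra_simps)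

text \<open>
  By the previous results, \<open>X\<close> can be moved both ways, up to the isometry \<open>M \<mapsto> U M V\<^sup>T\<close>, in every
  direction of a symmetric block of trace zero of size at least \<open>k - r + 2\<close>. These directions form a space
  of dimension at least \<open>(k - r + 2)(k - r + 3)/2 - 1\<close>, which by the bound on \<open>dim S\<close> leaves room for a
  direction orthogonal to \<open>S\<close>.
\<close>

lemma hull_spectral_domain_perturbation:
  fixes f :: "real^'n \<Rightarrow> real" and X :: "real^'p^'n" and S :: "(real^'p^'n) set"
  assumes f: "convex_on UNIV f" "permutation_invariant f" "sign_invariant f"
    and le: "CARD('n) \<le> CARD('p)"
    and X: "X \<in> convex hull (spectral_domain r f)" "k < rank X"
    and r: "r \<le> k" and dim: "2 * (dim S + 2) \<le> (k - r + 2) * (k - r + 3)"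
  obtains \<Delta> where "\<Delta> \<noteq> 0" "X + \<Delta> \<in> convex hull (spectral_domain r f)"
    "X - \<Delta> \<in> convex hull (spectral_domain r f)" "\<And>B. B \<in> S \<Longrightarrow> B \<bullet> \<Delta> = 0"
proof -
  obtain U :: "real^'n^'n" and V :: "real^'n^'p" and s where
    UV: "transpose U ** U = mat 1" "transpose V ** V = mat 1" and s: "\<forall>i. 0 \<le> s $ i"
    and X_eq: "X = U ** diag_matrix s ** transpose V"
    by (rule svdE[OF le, of X])
  define E where "E = sparse_sublevel r f"
  have sE: "s \<in> convex hull E"
    using X(1) unfolding X_eq svd_in_hull_spectral_domain_iff[OF f UV le] E_def .
  have supp: "k < card {i. s $ i \<noteq> 0}"
    using X(2) unfolding X_eq rank_svd[OF UV] .
  have perm: "(\<chi> l. x $ \<pi> l) \<in> E" if "x \<in> E" "bij \<pi>" for x \<pi>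
  proof -
    have "(\<chi> l. x $ \<pi> l) \<in> signed_permutations x"
      unfolding signed_permutations_def using that(2)
      by (intro CollectI exI[of _ "\<lambda>_. True"] exI[of _ \<pi>]) simp
    then show ?thesis
      using that(1) signed_permutations_invariant[OF f(2,3), of "\<chi> l. x $ \<pi> l" x]
      by (simp add: E_def sparse_sublevel_def)
  qed
  have sparse: "card {l. x $ l \<noteq> 0} \<le> r" if "x \<in> E" for x
    using that by (simp add: E_def sparse_sublevel_def)
  obtain J where J: "k + 2 \<le> card J + r" "J \<noteq> {}"
    "\<And>i j. i \<in> J \<Longrightarrow> j \<in> J \<Longrightarrow> axis i 1 - axis j 1 \<in> two_sided_directions (convex hull E) s"
    using exchangeable_coordinates[OF perm sparse sE s supp] by blast
  define C where "C = (\<lambda>M. U ** M ** transpose V) -` (convex hull (spectral_domain r f))"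
  have C: "convex C"
    unfolding C_def by (intro convex_linear_vimage linear_sandwich convex_convex_hull)
  have conj: "W ** diag_matrix \<nu> ** transpose W \<in> C"
    if W: "transpose W ** W = mat 1" and \<nu>: "\<nu> \<in> convex hull E" for W :: "real^'n^'n" and \<nu>
  proof -
    have "transpose (Q ** W) ** (Q ** W) = mat 1" if "transpose Q ** Q = mat 1" for Q :: "real^'n^'q"
    proof -
      have "transpose (Q ** W) ** (Q ** W) = transpose W ** (transpose Q ** Q) ** W"
        by (simp add: matrix_transpose_mul matrix_mul_assoc)
      then show ?thesis by (simp add: that W)
    qed
    note orth = this[OF UV(1)] this[OF UV(2)]
    have "U ** W ** diag_matrix \<nu> ** transpose (V ** W) \<in> convex hull (spectral_domain r f)"
      using \<nu> unfolding E_def svd_in_hull_spectral_domain_iff[OF f orth le] .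
    then show ?thesis
      by (simp add: C_def matrix_transpose_mul matrix_mul_assoc)
  qed
  define T where "T = span (pair_matrix ` {p. p \<subseteq> J \<and> card p \<in> {1, 2}})"
  \<comment> \<open>Orthogonality to \<open>mat 1\<close> expresses that the trace is zero; this costs one more dimension.\<close>
  define S' where "S' = insert (mat 1) ((\<lambda>B. transpose U ** B ** V) ` S)"
  have "dim ((\<lambda>B. transpose U ** B ** V) ` S) \<le> dim S"
    by (intro dim_image_le linear_sandwich)
  then have "dim S' \<le> dim S + 1"
    unfolding S'_def dim_insert by simp
  moreover have "2 * (dim S + 2) \<le> 2 * dim T"
  proof -
    have "(k - r + 2) * (k - r + 3) \<le> card J * (card J + 1)"
      using J(1) r by (intro mult_le_mono) auto
    then show ?thesis
      using dim unfolding T_def dim_pair_matrices by linarith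
  qed
  ultimately have "dim S' < dim T" by simp
  then obtain d where d: "d \<in> T" "d \<noteq> 0" "\<And>B. B \<in> S' \<Longrightarrow> B \<bullet> d = 0"
    using exists_nonzero_orthogonal_in_subspace[of T S'] unfolding T_def by blast
  have "d \<in> two_sided_directions C (diag_matrix s)"
    by (rule traceless_block_direction[OF sE C conj J(3) J(2)])
      (use d in \<open>auto simp: T_def S'_def\<close>)
  then obtain t where t: "0 < t" "diag_matrix s + t *\<^sub>R d \<in> C" "diag_matrix s - t *\<^sub>R d \<in> C"
    by (auto simp: two_sided_directions_def)
  interpret L: linear "\<lambda>M. U ** M ** transpose V"
    by (rule linear_sandwich)
  define \<Delta> where "\<Delta> = U ** (t *\<^sub>R d) ** transpose V"
  show ?thesis
  proof (rule that)
    have "transpose U ** \<Delta> ** V = t *\<^sub>R d"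
      unfolding \<Delta>_def by (rule compression_svd[OF UV])
    then show "\<Delta> \<noteq> 0"
      using t(1) d(2) by auto
    show "X + \<Delta> \<in> convex hull (spectral_domain r f)" "X - \<Delta> \<in> convex hull (spectral_domain r f)"
      using t(2,3) unfolding C_def X_eq \<Delta>_def by (simp_all add: L.add L.diff)
    show "B \<bullet> \<Delta> = 0" if "B \<in> S" for B
    proof -
      have "(transpose U ** B ** V) \<bullet> d = 0"
        using that by (intro d(3)) (auto simp: S'_def)
      then show ?thesis
        unfolding \<Delta>_def inner_sandwich transpose_transpose inner_scaleR_right by simp
    qed
  qed
qed

section \<open>Compactness of the spectral domain\<close>

lemma compact_orthonormal_columns: "compact {Q :: real^'n^'p. transpose Q ** Q = mat 1}"
proof -
  let ?O = "{Q :: real^'n^'p. transpose Q ** Q = mat 1}"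
  have "bounded ?O"
    unfolding bounded_iff
  proof (intro exI ballI)
    fix Q :: "real^'n^'p" assume Q: "Q \<in> ?O"
    have "(norm Q)\<^sup>2 = Q \<bullet> (Q ** mat 1)"
      by (simp add: power2_norm_eq_inner)
    also have "\<dots> = (transpose Q ** Q) \<bullet> mat 1"
      by (rule inner_matrix_mult_left)
    also have "\<dots> = real CARD('n)"
      using Q by (simp add: inner_vec_def mat_def if_distrib[of "\<lambda>z. z * _"] cong: if_cong)
    finally have "norm Q = sqrt CARD('n)"
      by (metis norm_ge_zero real_sqrt_unique)
    then show "norm Q \<le> sqrt CARD('n)" by simp
  qed
  moreover have "closed ?O"
    unfolding transpose_def matrix_matrix_mult_def
    by (intro closed_Collect_eq continuous_intros)
  ultimately show ?thesis by (simp add: compact_eq_bounded_closed)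
qed

text \<open>
  If \<open>f x \<le> 0\<close> had a solution with one entry exceeding the 1-norm of \<open>w\<close>, then \<open>w\<close> would arise from \<open>x\<close> by
  a substochastic matrix that spreads that single entry, and \<open>f w \<le> f x\<close> would contradict \<open>0 < f w\<close>.
\<close>

lemma bounded_sublevel:
  fixes f :: "real^'n \<Rightarrow> real"
  assumes f: "convex_on UNIV f" "permutation_invariant f" "sign_invariant f" and pos: "0 < f w"
  shows "bounded {x. f x \<le> 0}"
proof -
  define R where "R = (\<Sum>i\<in>UNIV. \<bar>w $ i\<bar>)"
  have small: "\<bar>x $ i\<bar> \<le> R" if "f x \<le> 0" for x i
  proof (rule ccontr)
    assume "\<not> \<bar>x $ i\<bar> \<le> R"
    moreover have "0 \<le> R" by (simp add: R_def sum_nonneg)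
    ultimately have xi: "R < \<bar>x $ i\<bar>" "x $ i \<noteq> 0" by auto
    define M where "M = (\<lambda>a b. if b = i then w $ a / x $ i else 0)"
    have R1: "\<bar>w $ a\<bar> \<le> R" for a
      unfolding R_def by (rule member_le_sum) auto
    have "(\<Sum>b\<in>UNIV. \<bar>M a b\<bar>) \<le> 1" for a
      using xi R1[of a] by (simp add: M_def if_distrib[of abs] divide_le_eq_1 cong: if_cong)
    moreover have "(\<Sum>a\<in>UNIV. \<bar>M a b\<bar>) \<le> 1" for b
      using xi by (cases "b = i") (simp_all add: M_def R_def divide_le_eq_1 flip: sum_divide_distrib)
    ultimately have "(\<chi> a. \<Sum>b\<in>UNIV. M a b * x $ b) \<in> convex hull (signed_permutations x)"
      by (rule substochastic_mult_in_hull)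
    also have "(\<chi> a. \<Sum>b\<in>UNIV. M a b * x $ b) = w"
      using xi(2) by (simp add: M_def vec_eq_iff if_distrib[of "\<lambda>z. z * _"] cong: if_cong)
    finally have "f w \<le> f x"
      by (rule hull_signed_permutations_le[OF f])
    with that pos show False by simp
  qed
  show ?thesis
    unfolding bounded_iff
  proof (intro exI ballI)
    fix x assume "x \<in> {x. f x \<le> 0}"
    then have "(\<Sum>i\<in>UNIV. \<bar>x $ i\<bar>) \<le> (\<Sum>i\<in>(UNIV :: 'n set). R)"
      using small by (intro sum_mono) auto
    then show "norm x \<le> (\<Sum>i\<in>(UNIV :: 'n set). R)"
      using norm_le_l1_cart[of x] by linarith
  qed
qed

text \<open>
  The spectral domain is the continuous image, under \<open>(U, V, x) \<mapsto> U diag(x) V\<^sup>T\<close>, of a product of compact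
  sets.
\<close>

lemma compact_spectral_domain:
  fixes f :: "real^'n \<Rightarrow> real"
  assumes f: "convex_on UNIV f" "permutation_invariant f" "sign_invariant f"
    and cont: "continuous_on UNIV f" and pos: "0 < f w" and le: "CARD('n) \<le> CARD('p)"
  shows "compact (spectral_domain k f :: (real^'p^'n) set)"
proof -
  have "sparse_sublevel k f = {x. f x \<le> 0} \<inter> (\<Union>I\<in>{I. card I \<le> k}. \<Inter>i\<in>- I. {x. x $ i = 0})"
  proof (intro set_eqI iffI)
    fix x assume "x \<in> sparse_sublevel k f"
    then show "x \<in> {x. f x \<le> 0} \<inter> (\<Union>I\<in>{I. card I \<le> k}. \<Inter>i\<in>- I. {x. x $ i = 0})"
      by (auto simp: sparse_sublevel_def intro!: exI[of _ "{i. x $ i \<noteq> 0}"])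
  next
    fix x assume "x \<in> {x. f x \<le> 0} \<inter> (\<Union>I\<in>{I. card I \<le> k}. \<Inter>i\<in>- I. {x. x $ i = 0})"
    then obtain I where I: "f x \<le> 0" "card I \<le> k" "\<forall>i\<in>- I. x $ i = 0" by auto
    then have "card {i. x $ i \<noteq> 0} \<le> card I"
      by (intro card_mono) auto
    with I show "x \<in> sparse_sublevel k f"
      by (simp add: sparse_sublevel_def)
  qed
  moreover have "compact {x. f x \<le> 0}"
    using bounded_sublevel[OF f pos] closed_Collect_le[OF cont continuous_on_const, of 0]
    by (simp add: compact_eq_bounded_closed)
  moreover have "closed (\<Union>I\<in>{I. card I \<le> k}. \<Inter>i\<in>- I. {x :: real^'n. x $ i = 0})"
    by (intro closed_UN closed_INT ballI closed_Collect_eq continuous_intros) simp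
  ultimately have E: "compact (sparse_sublevel k f)"
    by (simp add: compact_Int_closed)
  let ?O = "{U :: real^'n^'n. transpose U ** U = mat 1}"
  let ?St = "{V :: real^'n^'p. transpose V ** V = mat 1}"
  let ?g = "\<lambda>(U :: real^'n^'n, V :: real^'n^'p, x). U ** diag_matrix x ** transpose V"
  have "spectral_domain k f = ?g ` (?O \<times> ?St \<times> sparse_sublevel k f)"
  proof (intro set_eqI iffI)
    fix X :: "real^'p^'n" assume X: "X \<in> spectral_domain k f"
    obtain U :: "real^'n^'n" and V :: "real^'n^'p" and s where
      UV: "transpose U ** U = mat 1" "transpose V ** V = mat 1" and s: "\<forall>i. 0 \<le> s $ i"
      and X_eq: "X = U ** diag_matrix s ** transpose V"
      by (rule svdE[OF le, of X])
    have "s \<in> sparse_sublevel k f"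
      using X unfolding X_eq svd_in_spectral_domain_iff[OF f UV le] .
    then show "X \<in> ?g ` (?O \<times> ?St \<times> sparse_sublevel k f)"
      using UV X_eq by (intro image_eqI[of _ _ "(U, V, s)"]) auto
  qed (auto simp: svd_in_spectral_domain_iff[OF f _ _ le])
  moreover have "compact (?O \<times> ?St \<times> sparse_sublevel k f)"
    by (intro compact_Times compact_orthonormal_columns E)
  moreover have "continuous_on (?O \<times> ?St \<times> sparse_sublevel k f) ?g"
  proof -
    have "?g = (\<lambda>z. \<chi> i l. \<Sum>j\<in>UNIV. fst z $ i $ j * snd (snd z) $ j * fst (snd z) $ l $ j)"
      by (auto simp: fun_eq_iff vec_eq_iff diag_matrix_sandwich_nth transpose_def)
    then show ?thesis
      by (simp only:) (intro continuous_intros)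
  qed
  ultimately show ?thesis
    by (simp add: compact_continuous_image)
qed

text \<open>
  The remaining case of the dichotomy: if \<open>f\<close> is nowhere positive, every matrix of rank at most one
  is admissible, and a singular value decomposition exhibits any matrix as an average of such matrices.
\<close>

lemma hull_spectral_domain_UNIV:
  fixes f :: "real^'n \<Rightarrow> real"
  assumes f: "convex_on UNIV f" "permutation_invariant f" "sign_invariant f"
    and le: "CARD('n) \<le> CARD('p)" and k: "1 \<le> k" and neg: "\<And>x. f x \<le> 0"
  shows "convex hull (spectral_domain k f) = (UNIV :: (real^'p^'n) set)"
proof (intro equalityI subsetI UNIV_I)
  fix X :: "real^'p^'n"
  obtain U :: "real^'n^'n" and V :: "real^'n^'p" and s where
    UV: "transpose U ** U = mat 1" "transpose V ** V = mat 1" and s: "\<forall>i. 0 \<le> s $ i"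
    and X_eq: "X = U ** diag_matrix s ** transpose V"
    by (rule svdE[OF le, of X])
  let ?n = "real CARD('n)"
  have axis: "axis i c \<in> sparse_sublevel k f" for i c
  proof -
    have "card {j. axis i c $ j \<noteq> 0} \<le> card {i}"
      by (intro card_mono) (auto simp: axis_def)
    then show ?thesis
      using k neg by (simp add: sparse_sublevel_def)
  qed
  have "(\<Sum>i\<in>UNIV. (1 / ?n) *\<^sub>R axis i (?n * s $ i)) \<in> convex hull (sparse_sublevel k f)"
    by (intro convex_sum convex_convex_hull hull_inc axis) auto
  also have "(\<Sum>i\<in>UNIV. (1 / ?n) *\<^sub>R axis i (?n * s $ i)) = s"
    by (simp add: vec_eq_iff axis_def if_distrib[of "\<lambda>z. z / _"] cong: if_cong)
  finally show "X \<in> convex hull (spectral_domain k f)"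
    unfolding X_eq svd_in_hull_spectral_domain_iff[OF f UV le] .
qed

section \<open>The relaxation and its optimal value\<close>

lemma
  fixes S :: "'a::real_inner set"
  shows closed_feasible_set: "closed S \<Longrightarrow> closed (feasible_set S m A bl bu)"
    and convex_feasible_set: "convex S \<Longrightarrow> convex (feasible_set S m A bl bu)"
proof -
  have eq: "feasible_set S m A bl bu
    = S \<inter> (\<Inter>i\<in>{1..m}. {X. bl i \<le> ereal (A i \<bullet> X)} \<inter> {X. ereal (A i \<bullet> X) \<le> bu i})"
    by (auto simp: feasible_set_def)
  show "closed (feasible_set S m A bl bu)" if "closed S"
    unfolding eq using that
    by (intro closed_Int closed_INT ballI closed_Collect_le continuous_intros continuous_on_ereal)
  have "convex {X. b \<le> ereal (a \<bullet> X)}" "convex {X. ereal (a \<bullet> X) \<le> b}" for a :: 'a and b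
    by (cases b; simp add: convex_halfspace_le convex_halfspace_ge)+
  then show "convex (feasible_set S m A bl bu)" if "convex S"
    unfolding eq using that by (intro convex_Int convex_INT)
qed

lemma compact_linear_min_at_extreme_point:
  fixes F :: "'a::euclidean_space set"
  assumes F: "compact F" "convex F" "F \<noteq> {}"
  obtains x where "x extreme_point_of F" "\<forall>y\<in>F. c \<bullet> x \<le> c \<bullet> y"
proof -
  have "continuous_on F (\<lambda>x. c \<bullet> x)"
    by (intro continuous_intros)
  then obtain x0 where x0: "x0 \<in> F" "\<And>y. y \<in> F \<Longrightarrow> c \<bullet> x0 \<le> c \<bullet> y"
    using continuous_attains_inf[OF F(1,3)] by blast
  let ?G = "F \<inter> {x. c \<bullet> x = c \<bullet> x0}"
  have face: "?G face_of F"
    by (rule face_of_Int_supporting_hyperplane_ge[OF F(2) x0(2)])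
  have "compact ?G" "convex ?G" "?G \<noteq> {}"
    using F x0(1) by (auto intro!: compact_Int_closed convex_Int closed_hyperplane convex_hyperplane)
  then obtain x where x: "x extreme_point_of ?G"
    by (rule extreme_point_exists_convex)
  then have "x extreme_point_of F" "c \<bullet> x = c \<bullet> x0"
    using extreme_point_of_face[OF face] by auto
  with x0(2) show ?thesis by (intro that) auto
qed

theorem proposition3:
  fixes f :: "real^'n \<Rightarrow> real"
    and A :: "nat \<Rightarrow> real^'p^'n"
    and bl bu :: "nat \<Rightarrow> ereal"
    and k k' m m' :: nat
    and D :: "(real^'p^'n) set"
  assumes "1 \<le> k" "k \<le> CARD('n)" "CARD('n) \<le> CARD('p)"
    and "continuous_on UNIV f" "convex_on UNIV f"
    and "permutation_invariant f" "sign_invariant f"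
    and "\<forall>i\<in>{1..m}. bl i \<le> bu i"
    and "D = spectral_domain k f"
    and "k' = strengthened_rank TYPE('p) k f"
    and "m' = dim (span (A ` {1..m}))"
    and "real m' \<le> (real k - real k' + 2) * (real k - real k' + 3) / 2 - 2"
  shows "(\<forall>X. X extreme_point_of feasible_set (convex hull D) m A bl bu \<longrightarrow> rank X \<le> k) \<and>
    (- \<infinity> < optimal_value (convex hull D) m A bl bu \<and>
       \<not> contains_line (feasible_set (convex hull D) m A bl bu) \<longrightarrow>
     optimal_value D m A bl bu = optimal_value (convex hull D) m A bl bu)"
proof -
  note le = assms(3) and f = assms(5-7)
  let ?F = "feasible_set (convex hull D) m A bl bu"
  have "1 \<le> k' \<and> k' \<le> k \<and>
      convex hull (spectral_domain k f :: (real^'p^'n) set) = convex hull (spectral_domain k' f)"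
    unfolding assms(10) strengthened_rank_def by (rule LeastI[of _ k]) (use assms(1) in auto)
  then have k': "k' \<le> k" and hull: "convex hull D = convex hull (spectral_domain k' f)"
    by (auto simp: assms(9))
  have "real (2 * (m' + 2)) \<le> real ((k - k' + 2) * (k - k' + 3))"
    using assms(12) of_nat_diff[OF k', where 'a = real] by (simp only: of_nat_mult of_nat_add) simp
  then have dim: "2 * (dim (A ` {1..m}) + 2) \<le> (k - k' + 2) * (k - k' + 3)"
    unfolding assms(11) dim_span of_nat_le_iff .
  have feasible_shift: "X + d \<in> ?F"
    if "X \<in> ?F" "X + d \<in> convex hull D" "\<And>i. i \<in> {1..m} \<Longrightarrow> A i \<bullet> d = 0" for X d
    using that by (simp add: feasible_set_def inner_add)
  \<comment> \<open>A feasible point of rank above \<open>k\<close> is the midpoint of a nondegenerate feasible segment along which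
    all constraint functionals are constant.\<close>
  have perturb: "\<exists>\<Delta>. \<Delta> \<noteq> 0 \<and> (\<forall>i\<in>{1..m}. A i \<bullet> \<Delta> = 0) \<and> X + \<Delta> \<in> ?F \<and> X - \<Delta> \<in> ?F"
    if X: "X \<in> ?F" "k < rank X" for X
  proof -
    have "X \<in> convex hull (spectral_domain k' f)"
      using X(1) hull by (simp add: feasible_set_def)
    from hull_spectral_domain_perturbation[OF f le this X(2) k' dim]
    obtain \<Delta> where \<Delta>: "\<Delta> \<noteq> 0" "X + \<Delta> \<in> convex hull D" "X - \<Delta> \<in> convex hull D"
      "\<And>B. B \<in> A ` {1..m} \<Longrightarrow> B \<bullet> \<Delta> = 0"
      unfolding hull by blast
    then show ?thesis
      using feasible_shift[OF X(1), of \<Delta>] feasible_shift[OF X(1), of "- \<Delta>"] by auto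
  qed
  have extreme: "rank X \<le> k" if X: "X extreme_point_of ?F" for X
  proof (rule ccontr)
    assume "\<not> rank X \<le> k"
    moreover have "X \<in> ?F"
      using X by (simp add: extreme_point_of_def)
    ultimately obtain \<Delta> where \<Delta>: "\<Delta> \<noteq> 0" "X + \<Delta> \<in> ?F" "X - \<Delta> \<in> ?F"
      using perturb[of X] by auto
    have "midpoint (X - \<Delta>) (X + \<Delta>) = X"
      by (simp add: midpoint_def flip: scaleR_2)
    moreover have "X - \<Delta> \<noteq> X + \<Delta>"
    proof
      assume "X - \<Delta> = X + \<Delta>"
      then have "2 *\<^sub>R \<Delta> = 0"
        by (simp add: scaleR_2 diff_eq_eq add.assoc)
      with \<Delta>(1) show False by simp
    qed
    ultimately have "X \<in> open_segment (X - \<Delta>) (X + \<Delta>)"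
      by (metis midpoint_in_open_segment)
    with X \<Delta>(2,3) show False
      unfolding extreme_point_of_def by blast
  qed
  have low_rank: "X \<in> feasible_set D m A bl bu" if "X \<in> ?F" "rank X \<le> k" for X
    using that hull_spectral_domain_rank_le[OF f le, of X k k]
    by (simp add: feasible_set_def assms(9))
  have "feasible_set D m A bl bu \<subseteq> ?F"
    by (auto simp: feasible_set_def intro: hull_inc)
  then have opt_ge: "optimal_value (convex hull D) m A bl bu \<le> optimal_value D m A bl bu"
    unfolding optimal_value_def by (rule INF_superset_mono) simp
  have "optimal_value D m A bl bu \<le> optimal_value (convex hull D) m A bl bu"
    if no_line: "\<not> contains_line ?F"
  proof (cases "\<forall>X\<in>?F. rank X \<le> k")
    case True
    then have "?F \<subseteq> feasible_set D m A bl bu"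
      using low_rank by blast
    then show ?thesis
      unfolding optimal_value_def by (rule INF_superset_mono) simp
  next
    case False
    then obtain X where X: "X \<in> ?F" "k < rank X" by auto
    \<comment> \<open>Otherwise the hull is the whole space and the segment extends to a feasible line.\<close>
    have "\<exists>w. 0 < f w"
    proof (rule ccontr)
      assume neg: "\<not> ?thesis"
      obtain \<Delta> where \<Delta>: "\<Delta> \<noteq> 0" "\<forall>i\<in>{1..m}. A i \<bullet> \<Delta> = 0"
        using perturb[OF X] by blast
      have "convex hull D = UNIV"
        unfolding assms(9) using neg
        by (intro hull_spectral_domain_UNIV[OF f le assms(1)]) (auto simp: not_less)
      then have "X + t *\<^sub>R \<Delta> \<in> ?F" for t
        using \<Delta>(2) by (intro feasible_shift[OF X(1)]) auto
      with \<Delta>(1) no_line show False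
        unfolding contains_line_def by blast
    qed
    then obtain w where "0 < f w" by blast
    then have "compact (convex hull D)"
      unfolding assms(9) by (intro compact_convex_hull compact_spectral_domain[OF f assms(4) _ le])
    then have "compact (?F \<inter> convex hull D)"
      by (intro closed_Int_compact closed_feasible_set compact_imp_closed)
    moreover have "?F \<inter> convex hull D = ?F"
      by (auto simp: feasible_set_def)
    ultimately have F: "compact ?F" "convex ?F" "?F \<noteq> {}"
      using X(1) by (auto intro: convex_feasible_set)
    obtain Y where Y: "Y extreme_point_of ?F" "\<forall>Z\<in>?F. A 0 \<bullet> Y \<le> A 0 \<bullet> Z"
      by (rule compact_linear_min_at_extreme_point[OF F, of "A 0"])
    have "Y \<in> feasible_set D m A bl bu"
      using Y(1) low_rank extreme by (simp add: extreme_point_of_def)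
    then have "optimal_value D m A bl bu \<le> ereal (A 0 \<bullet> Y)"
      unfolding optimal_value_def by (rule INF_lower)
    also have "\<dots> \<le> optimal_value (convex hull D) m A bl bu"
      unfolding optimal_value_def using Y(2) by (intro INF_greatest) simp
    finally show ?thesis .
  qed
  with opt_ge extreme show ?thesis
    by (auto intro: antisym)
qed

end
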